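(* Let $d\ge1$, $n\ge0$ and $\lambda\in\mathbb R$. Let $\widehat\Pi$ be a regular $\mathrm{proj}(\mathbb R^d)$-equivariant pencil lifting of $\mathcal D^{(n)}_\lambda(\mathbb R^d)$, written in the form $$\widehat\Pi(\Delta)=\sum_{i=0}^n\frac{P_i(\widehat w)}{P_i(\lambda)}\,\widehat\Pi^{\rm DLO}_\lambda(\Delta_{n-i}),$$ where $\Delta=\Delta_n+\dots+\Delta_0$ is the canonical decomposition of $\Delta\in\mathcal D^{(n)}_\lambda(\mathbb R^d)$ and $P_i$ is a real polynomial of degree $\le i$ with $P_i(\lambda)\ne0$ ($i=0,\dots,n$). Suppose that for all $i$ $$P_i(\widehat w)^*=(-1)^iP_i(\widehat w),$$ i.e. the polynomials with even index are self-adjoint, $P_{2i}(\widehat w)=\sum_kc_k\left(\widehat w-\tfrac12\right)^{2k}$, and the polynomials with odd index are anti-self-adjoint, $P_{2i+1}(\widehat w)=\sum_kc_k\left(\widehat w-\tfrac12\right)^{2k+1}$ (with coefficients $c_k$ depending on the polynomial). Then, if $n$ is even, $\widehat\Pi$ is self-adjoint, i.e. $\widehat\Pi(\Delta)^*=\widehat\Pi(\Delta)$ for all $\Delta\in\mathcal D^{(n)}_\lambda(\mathbb R^d)$; and if $n$ is odd, $\widehat\Pi$ is anti-self-adjoint, i.e. $\widehat\Pi(\Delta)^*=-\widehat\Pi(\Delta)$ for all $\Delta\in\mathcal D^{(n)}_\lambda(\mathbb R^d)$.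
   Context: Densities and operators. $\mathcal F_\lambda(\mathbb R^d)$ is the space of smooth densities $s(x)|Dx|^\lambda$ of weight $\lambda$; $\mathcal F(\mathbb R^d)=\bigoplus_\lambda\mathcal F_\lambda(\mathbb R^d)$ is the (commutative) algebra of densities, with weight operator $\widehat w(\boldsymbol s)=\lambda\boldsymbol s$ for $\boldsymbol s\in\mathcal F_\lambda$. $\mathcal D^{(n)}_\lambda(\mathbb R^d)$ is the space of linear differential operators of order $\le n$ from $\mathcal F_\lambda$ to $\mathcal F_\lambda$. $\mathcal D^{(n)}(\widehat{\mathbb R^d})$ is the space of weight-zero (preserving each $\mathcal F_\mu$) differential operators of order $\le n$ on the algebra $\mathcal F(\mathbb R^d)$, i.e. polynomials in $\partial_i$ and $\widehat w$ of total degree $\le n$ with coefficients functions of $x$. An operator on $\mathcal F$ is identified with the pencil of its restrictions $\widehat\Delta|_{\widehat w=\mu}$ to $\mathcal F_\mu$. Adjoint. For compactly supported densities $\boldsymbol s_i=s_i|Dx|^{\lambda_i}$, $\langle\boldsymbol s_1,\boldsymbol s_2\rangle=\int s_1s_2|Dx|$ if $\lambda_1+\lambda_2=1$ and $0$ otherwise; the adjoint is defined by $\langle\widehat\Delta\boldsymbol s_1,\boldsymbol s_2\rangle=\langle\boldsymbol s_1,\widehat\Delta^*\boldsymbol s_2\rangle$. In particular $\partial_i^*=-\partial_i$, $\widehat w^*=1-\widehat w$. Pencil liftings. A pencil lifting of $\mathcal D^{(n)}_\lambda$ is a linear map $\widehat\Pi$ from $\mathcal D^{(n)}_\lambda$ to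 weight-zero differential operators on $\mathcal F$ with $\widehat\Pi(\Delta)|_{\widehat w=\lambda}=\Delta$ for all $\Delta$; it is regular if it takes values in $\mathcal D^{(n)}(\widehat{\mathbb R^d})$. It is $\mathcal G$-equivariant for a Lie algebra $\mathcal G$ of vector fields if $\mathrm{ad}_{\mathbf K}(\widehat\Pi(\Delta))=\widehat\Pi(\mathrm{ad}_{\mathbf K}\Delta)$ for all $\mathbf K\in\mathcal G$, where $\mathrm{ad}_{\mathbf K}$ is the commutator with the Lie derivative $\mathcal L_{\mathbf K}$ on densities. $\mathrm{proj}(\mathbb R^d)$ is the Lie algebra spanned by the vector fields $\partial_i$, $x^k\partial_i$, and $x^k\sum_ix^i\partial_i$ ($i,k=1,\dots,d$). Full symbol map and quantisation (Lecomte–Ovsienko, a known result). For each $\mu\in\mathbb R$ there is a unique $\mathrm{proj}(\mathbb R^d)$-equivariant linear bijection $\sigma_\mu$ from differential operators on $\mathcal F_\mu$ to functions on $T^*\mathbb R^d$ polynomial in momenta $\xi_i$ (symmetric contravariant tensor fields, with the Lie derivative action) such that for $\Delta$ of order $\le k$, $\sigma_\mu(\Delta)$ equals the order-$k$ principal symbol $S^{i_1\dots i_k}\xi_{i_1}\cdots\xi_{i_k}$ plus terms of degree $<k$ in $\xi$. Its inverse $Q_\mu=\sigma_\mu^{-1}$ has the form $$Q_\mu(S^{i_1\dots i_k}\xi_{i_1}\cdots\xi_{i_k})=\sum_{r=0}^k\tilde c^{(k)}_r(\mu)\,\big(\partial_{j_1}\cdots\partial_{j_r}S^{j_1\dots j_ri_1\dots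 i_{k-r}}\big)\partial_{i_1}\cdots\partial_{i_{k-r}},$$ with $\tilde c^{(k)}_0=1$ and $\tilde c^{(k)}_r(\mu)$ polynomial in $\mu$ of degree $\le r$. DLO-pencil lifting. $\widehat\Pi^{\rm DLO}_\lambda(\Delta)|_{\widehat w=\mu}=Q_\mu(\sigma_\lambda(\Delta))$ for all $\mu$. Canonical decomposition. For $\Delta\in\mathcal D^{(n)}_\lambda(\mathbb R^d)$, $\Delta_n=Q_\lambda(\text{order-}n\text{ principal symbol of }\Delta)$, and inductively $\Delta_{n-k}=Q_\lambda(\text{order-}(n-k)\text{ principal symbol of }\Delta-\Delta_n-\dots-\Delta_{n-k+1})$; then $\Delta=\Delta_n+\dots+\Delta_0$. Equivalently, $\Delta_k=Q_\lambda$ of the component of $\sigma_\lambda(\Delta)$ homogeneous of degree $k$ in $\xi$. (Every regular $\mathrm{proj}(\mathbb R^d)$-equivariant pencil lifting can be written in the form displayed in the claim.) *)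

theory Defs
  imports
    "HOL-Analysis.Analysis"
    "HOL-Library.Poly_Mapping"
    "HOL-Computational_Algebra.Polynomial"
begin

section \<open>Smooth functions on \<open>\<real>\<^sup>d\<close>\<close>

text \<open>The dimension is \<open>d = CARD('d)\<close>.\<close>

definition pd :: "'d \<Rightarrow> (real^'d::finite \<Rightarrow> real) \<Rightarrow> real^'d \<Rightarrow> real" where
  "pd i f x = frechet_derivative f (at x) (axis i 1)"

primrec diff_times :: "nat \<Rightarrow> (real^'d::finite \<Rightarrow> real) \<Rightarrow> bool" where
  "diff_times 0 f \<longleftrightarrow> True"
| "diff_times (Suc k) f \<longleftrightarrow> (\<forall>x. f differentiable at x) \<and> (\<forall>i. diff_times k (pd i f))"

definition smooth :: "(real^'d::finite \<Rightarrow> real) \<Rightarrow> bool" where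
  "smooth f \<longleftrightarrow> (\<forall>k. diff_times k f)"

lemma pd_const: "pd i (\<lambda>x. c) = (\<lambda>x. 0)"
  by (simp add: pd_def fun_eq_iff)

lemma pd_eqI: "(f has_derivative D) (at x) \<Longrightarrow> pd i f x = D (axis i 1)"
  unfolding pd_def by (metis frechet_derivative_at)

lemma pd_has: "f differentiable at x \<Longrightarrow> (f has_derivative frechet_derivative f (at x)) (at x)"
  by (simp add: frechet_derivative_works)

lemma pd_add:
  assumes "\<forall>x. f differentiable at x" "\<forall>x. g differentiable at x"
  shows "pd i (\<lambda>x. f x + g x) = (\<lambda>x. pd i f x + pd i g x)"
proof
  fix x
  show "pd i (\<lambda>x. f x + g x) x = pd i f x + pd i g x"
    unfolding pd_def[of i f] pd_def[of i g]
    by (rule pd_eqI, rule has_derivative_add) (use assms pd_has in blast)+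
qed

lemma pd_mult:
  assumes "\<forall>x. f differentiable at x" "\<forall>x. g differentiable at x"
  shows "pd i (\<lambda>x. f x * g x) = (\<lambda>x. f x * pd i g x + pd i f x * g x)"
proof
  fix x
  show "pd i (\<lambda>x. f x * g x) x = f x * pd i g x + pd i f x * g x"
    unfolding pd_def[of i f] pd_def[of i g]
    by (rule pd_eqI, rule has_derivative_mult) (use assms pd_has in blast)+
qed

lemma diff_times_Suc_D: "diff_times (Suc k) f \<Longrightarrow> diff_times k f"
  by (induction k arbitrary: f) auto

lemma diff_times_const: "diff_times k (\<lambda>x. c)"
  by (induction k arbitrary: c) (auto simp: pd_const)

lemma diff_times_add: "diff_times k f \<Longrightarrow> diff_times k g \<Longrightarrow> diff_times k (\<lambda>x. f x + g x)"
  by (induction k arbitrary: f g) (auto simp: pd_add)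

lemma diff_times_mult: "diff_times k f \<Longrightarrow> diff_times k g \<Longrightarrow> diff_times k (\<lambda>x. f x * g x)"
proof (induction k arbitrary: f g)
  case (Suc k)
  have "diff_times k f" "diff_times k g"
    using Suc.prems by (auto intro: diff_times_Suc_D simp del: diff_times.simps)
  then show ?case
    using Suc by (auto simp: pd_mult intro!: diff_times_add)
qed simp

lemma smooth_const: "smooth (\<lambda>x. c)"
  by (simp add: smooth_def diff_times_const)

lemma smooth_add: "smooth f \<Longrightarrow> smooth g \<Longrightarrow> smooth (\<lambda>x. f x + g x)"
  by (simp add: smooth_def diff_times_add)

lemma smooth_mult: "smooth f \<Longrightarrow> smooth g \<Longrightarrow> smooth (\<lambda>x. f x * g x)"
  by (simp add: smooth_def diff_times_mult)

lemma smooth_uminus: "smooth f \<Longrightarrow> smooth (\<lambda>x. - f x)"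
  using smooth_mult[OF smooth_const[of "-1"], of f] by simp

lemma smooth_diff: "smooth f \<Longrightarrow> smooth g \<Longrightarrow> smooth (\<lambda>x. f x - g x)"
  using smooth_add[OF _ smooth_uminus, of f g] by simp

lemma smooth_pd: "smooth f \<Longrightarrow> smooth (pd i f)"
  by (metis smooth_def diff_times.simps(2))

lemma smooth_coord: "smooth (\<lambda>x::real^'d::finite. x $ k)"
proof -
  have D: "((\<lambda>x::real^'d. x $ k) has_derivative (\<lambda>x. x $ k)) (at x)" for x
    by (rule bounded_linear_imp_has_derivative) (rule bounded_linear_vec_nth)
  have "pd i (\<lambda>x::real^'d. x $ k) = (\<lambda>x. axis i 1 $ k)" for i
    using pd_eqI[OF D] by blast
  moreover have "(\<lambda>x::real^'d. x $ k) differentiable at x" for x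
    using D by (auto simp: differentiable_def)
  ultimately have "diff_times m (\<lambda>x::real^'d. x $ k)" for m
    by (cases m) (auto simp: diff_times_const)
  then show ?thesis by (simp add: smooth_def)
qed

typedef (overloaded) 'd cinf = "{f :: real^'d::finite \<Rightarrow> real. smooth f}"
  morphisms fn Cinf
  using smooth_const by blast

setup_lifting type_definition_cinf

instantiation cinf :: (finite) comm_ring_1
begin
lift_definition zero_cinf :: "'a cinf" is "\<lambda>x. 0" by (rule smooth_const)
lift_definition one_cinf :: "'a cinf" is "\<lambda>x. 1" by (rule smooth_const)
lift_definition plus_cinf :: "'a cinf \<Rightarrow> 'a cinf \<Rightarrow> 'a cinf" is "\<lambda>f g x. f x + g x"
  by (rule smooth_add)
lift_definition uminus_cinf :: "'a cinf \<Rightarrow> 'a cinf" is "\<lambda>f x. - f x" by (rule smooth_uminus)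
lift_definition minus_cinf :: "'a cinf \<Rightarrow> 'a cinf \<Rightarrow> 'a cinf" is "\<lambda>f g x. f x - g x"
  by (rule smooth_diff)
lift_definition times_cinf :: "'a cinf \<Rightarrow> 'a cinf \<Rightarrow> 'a cinf" is "\<lambda>f g x. f x * g x"
  by (rule smooth_mult)
instance
  by standard (transfer; simp add: algebra_simps fun_eq_iff)+
end

instantiation cinf :: (finite) real_algebra_1
begin
lift_definition scaleR_cinf :: "real \<Rightarrow> 'a cinf \<Rightarrow> 'a cinf" is "\<lambda>c f x. c * f x"
  by (intro smooth_mult smooth_const)
instance
  by standard (transfer; simp add: algebra_simps fun_eq_iff)+
end

lift_definition coord :: "'d::finite \<Rightarrow> 'd cinf" is "\<lambda>k x. x $ k" by (rule smooth_coord)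

lift_definition deriv_at :: "'d::finite \<Rightarrow> 'd cinf \<Rightarrow> 'd cinf" is pd by (rule smooth_pd)

definition derivs :: "'d::finite list \<Rightarrow> 'd cinf \<Rightarrow> 'd cinf" where
  "derivs is f = foldr deriv_at is f"


section \<open>Differential operators on densities of a fixed weight\<close>

text \<open>
  The density \<open>s(x)|Dx|\<^sup>\<lambda>\<close> of weight \<open>\<lambda>\<close> is represented by its coefficient \<open>s\<close> in the standard
  coordinates of \<open>\<real>\<^sup>d\<close>, so an operator on densities of weight \<open>\<lambda>\<close> is a map \<open>'d cinf \<Rightarrow> 'd cinf\<close>.
  The weight enters through the Lie derivative only. Coefficients are indexed by the sequences
  \<open>i\<^sub>1, \<dots>, i\<^sub>k\<close> of indices; they are not required to be symmetric, which yields the same operators.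
\<close>

type_synonym 'd dop = "'d cinf \<Rightarrow> 'd cinf"

definition diff_ops :: "nat \<Rightarrow> ('d::finite) dop set" where
  "diff_ops n = {A. \<exists>a. A = (\<lambda>f. \<Sum>is | length is \<le> n. a is * derivs is f)}"

definition all_diff_ops :: "('d::finite) dop set" where
  "all_diff_ops = (\<Union>n. diff_ops n)"

text \<open>Vector fields, with \<open>K $ i\<close> the coefficient of \<open>\<partial>\<^sub>i\<close>.\<close>

type_synonym 'd vfield = "('d cinf)^'d"

definition divergence :: "('d::finite) vfield \<Rightarrow> 'd cinf" where
  "divergence K = (\<Sum>i\<in>UNIV. deriv_at i (K $ i))"

definition lie_density :: "('d::finite) vfield \<Rightarrow> real \<Rightarrow> 'd dop" where
  "lie_density K \<mu> f = (\<Sum>i\<in>UNIV. K $ i * deriv_at i f) + \<mu> *\<^sub>R (divergence K * f)"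

definition ad_weight :: "real \<Rightarrow> ('d::finite) vfield \<Rightarrow> 'd dop \<Rightarrow> 'd dop" where
  "ad_weight \<mu> K A = (\<lambda>f. lie_density K \<mu> (A f) - A (lie_density K \<mu> f))"

definition proj_algebra :: "('d::finite) vfield set" where
  "proj_algebra = span (range (\<lambda>i. axis i 1)
     \<union> range (\<lambda>(k, i). axis i (coord k))
     \<union> range (\<lambda>k. \<chi> i. coord k * coord i))"


section \<open>The algebra of densities and its weight-zero operators\<close>

text \<open>
  The algebra of densities is the direct sum over all weights \<open>\<lambda> \<in> \<real>\<close>. A finitely supported
  function \<open>s :: real \<Rightarrow>\<^sub>0 'd cinf\<close> stands for the sum of the densities \<open>(lookup s \<lambda>)|Dx|\<^sup>\<lambda>\<close>;
  the convolution product of \<^type>\<open>poly_mapping\<close> is the product of densities. In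
  particular, multiplication by \<open>Poly_Mapping.single 0 a\<close> is multiplication by the function \<open>a\<close>.
\<close>

type_synonym 'd density = "real \<Rightarrow>\<^sub>0 'd cinf"
type_synonym 'd densop = "'d density \<Rightarrow> 'd density"

definition of_pencil :: "(real \<Rightarrow> ('d::finite) dop) \<Rightarrow> 'd densop" where
  "of_pencil A = Poly_Mapping.mapp A"

definition restrict_weight :: "('d::finite) densop \<Rightarrow> real \<Rightarrow> 'd dop" where
  "restrict_weight A \<mu> f = Poly_Mapping.lookup (A (Poly_Mapping.single \<mu> f)) \<mu>"

definition fmult :: "('d::finite) cinf \<Rightarrow> 'd densop" where
  "fmult a s = Poly_Mapping.single 0 a * s"

definition weight_op :: "('d::finite) densop" where
  "weight_op = of_pencil (\<lambda>\<mu> f. \<mu> *\<^sub>R f)"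

definition density_derivs :: "'d::finite list \<Rightarrow> 'd densop" where
  "density_derivs is = of_pencil (\<lambda>\<mu>. derivs is)"

definition lie_algebra_op :: "('d::finite) vfield \<Rightarrow> 'd densop" where
  "lie_algebra_op K = of_pencil (lie_density K)"

definition ad_density :: "('d::finite) vfield \<Rightarrow> 'd densop \<Rightarrow> 'd densop" where
  "ad_density K A = (\<lambda>s. lie_algebra_op K (A s) - A (lie_algebra_op K s))"

definition weight_zero_ops :: "nat \<Rightarrow> ('d::finite) densop set" where
  "weight_zero_ops n = {A. \<exists>a. A = (\<lambda>s.
     \<Sum>(is, j) | length is + j \<le> n. fmult (a is j) ((weight_op ^^ j) (density_derivs is s)))}"

definition all_weight_zero_ops :: "('d::finite) densop set" where
  "all_weight_zero_ops = (\<Union>n. weight_zero_ops n)"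

definition poly_weight :: "real poly \<Rightarrow> ('d::finite) densop" where
  "poly_weight p s = (\<Sum>k\<le>degree p. fmult (of_real (coeff p k)) ((weight_op ^^ k) s))"


section \<open>Pairing and adjoint\<close>

definition compactly_supported :: "('d::finite) density \<Rightarrow> bool" where
  "compactly_supported s \<longleftrightarrow>
     (\<forall>\<mu>. compact (closure {x. fn (Poly_Mapping.lookup s \<mu>) x \<noteq> 0}))"

definition pairing :: "('d::finite) density \<Rightarrow> 'd density \<Rightarrow> real" where
  "pairing s t = (\<Sum>\<mu>\<in>Poly_Mapping.keys s.
     \<integral>x. fn (Poly_Mapping.lookup s \<mu>) x * fn (Poly_Mapping.lookup t (1 - \<mu>)) x \<partial>lborel)"

text \<open>\<open>is_adjoint A B\<close> reads \<open>A\<^sup>* = B\<close>: since differential operators are local, at most one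
  differential operator \<open>B\<close> satisfies the defining identity of the pairing.\<close>

definition is_adjoint :: "('d::finite) densop \<Rightarrow> 'd densop \<Rightarrow> bool" where
  "is_adjoint A B \<longleftrightarrow> B \<in> all_weight_zero_ops \<and>
     (\<forall>s t. compactly_supported s \<longrightarrow> compactly_supported t \<longrightarrow>
        pairing (A s) t = pairing s (B t))"


section \<open>Symbols and the projectively equivariant full symbol map\<close>

text \<open>A symbol is a function \<open>F x \<xi>\<close> on \<open>T\<^sup>*\<real>\<^sup>d\<close>.\<close>

type_synonym 'd symb = "real^'d \<Rightarrow> real^'d \<Rightarrow> real"

definition symbols_below :: "nat \<Rightarrow> ('d::finite) symb set" where
  "symbols_below k = {F. \<exists>a. F = (\<lambda>x \<xi>. \<Sum>is | length is < k. fn (a is) x * (\<Prod>i\<leftarrow>is. \<xi> $ i))}"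

definition all_symbols :: "('d::finite) symb set" where
  "all_symbols = (\<Union>k. symbols_below k)"

text \<open>The Lie derivative of symmetric contravariant tensor fields: the Poisson bracket of the
  Hamiltonian \<open>\<Sum>\<^sub>i K\<^sup>i \<xi>\<^sub>i\<close> with \<open>F\<close>.\<close>

definition lie_symbol :: "('d::finite) vfield \<Rightarrow> 'd symb \<Rightarrow> 'd symb" where
  "lie_symbol K F = (\<lambda>x \<xi>.
     (\<Sum>i\<in>UNIV. fn (K $ i) x * pd i (\<lambda>y. F y \<xi>) x)
     - (\<Sum>i\<in>UNIV. \<Sum>j\<in>UNIV. fn (deriv_at j (K $ i)) x * \<xi> $ i * pd j (F x) \<xi>))"

definition principal_symbol :: "nat \<Rightarrow> ('d::finite) dop \<Rightarrow> 'd symb" where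
  "principal_symbol k A = (THE S. \<exists>a.
     A = (\<lambda>f. \<Sum>is | length is \<le> k. a is * derivs is f) \<and>
     S = (\<lambda>x \<xi>. \<Sum>is | length is = k. fn (a is) x * (\<Prod>i\<leftarrow>is. \<xi> $ i)))"

definition full_symbol_map :: "real \<Rightarrow> (('d::finite) dop \<Rightarrow> 'd symb) \<Rightarrow> bool" where
  "full_symbol_map \<mu> \<sigma> \<longleftrightarrow>
     bij_betw \<sigma> all_diff_ops all_symbols \<and>
     (\<forall>A\<in>all_diff_ops. \<forall>B\<in>all_diff_ops.
        \<sigma> (\<lambda>f. A f + B f) = (\<lambda>x \<xi>. \<sigma> A x \<xi> + \<sigma> B x \<xi>)) \<and>
     (\<forall>c. \<forall>A\<in>all_diff_ops. \<sigma> (\<lambda>f. c *\<^sub>R A f) = (\<lambda>x \<xi>. c * \<sigma> A x \<xi>)) \<and>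
     (\<forall>K\<in>proj_algebra. \<forall>A\<in>all_diff_ops. \<sigma> (ad_weight \<mu> K A) = lie_symbol K (\<sigma> A)) \<and>
     (\<forall>k. \<forall>A\<in>diff_ops k. \<exists>R\<in>symbols_below k.
        \<sigma> A = (\<lambda>x \<xi>. principal_symbol k A x \<xi> + R x \<xi>))"

text \<open>In the following definitions \<open>\<sigma> \<mu>\<close> is the full symbol map on densities of weight \<open>\<mu>\<close>; it is a
  parameter, since the defining property determines it on differential operators only.\<close>

definition quantise :: "(real \<Rightarrow> ('d::finite) dop \<Rightarrow> 'd symb) \<Rightarrow> real \<Rightarrow> 'd symb \<Rightarrow> 'd dop" where
  "quantise \<sigma> \<mu> = inv_into all_diff_ops (\<sigma> \<mu>)"

definition dlo_lifting ::
  "(real \<Rightarrow> ('d::finite) dop \<Rightarrow> 'd symb) \<Rightarrow> real \<Rightarrow> 'd dop \<Rightarrow> 'd densop" where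
  "dlo_lifting \<sigma> \<nu> \<Delta> = of_pencil (\<lambda>\<mu>. quantise \<sigma> \<mu> (\<sigma> \<nu> \<Delta>))"

text \<open>\<open>canonical_remainder \<sigma> \<nu> n \<Delta> k = \<Delta> - \<Delta>\<^sub>n - \<dots> - \<Delta>\<^bsub>n-k+1\<^esub>\<close>, and
  \<open>canonical_part \<sigma> \<nu> n \<Delta> k = \<Delta>\<^bsub>n-k\<^esub>\<close> for \<open>k \<le> n\<close>.\<close>

primrec canonical_remainder ::
  "(real \<Rightarrow> ('d::finite) dop \<Rightarrow> 'd symb) \<Rightarrow> real \<Rightarrow> nat \<Rightarrow> 'd dop \<Rightarrow> nat \<Rightarrow> 'd dop" where
  "canonical_remainder \<sigma> \<nu> n \<Delta> 0 = \<Delta>"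
| "canonical_remainder \<sigma> \<nu> n \<Delta> (Suc k) = (\<lambda>f. canonical_remainder \<sigma> \<nu> n \<Delta> k f
     - quantise \<sigma> \<nu> (principal_symbol (n - k) (canonical_remainder \<sigma> \<nu> n \<Delta> k)) f)"

definition canonical_part ::
  "(real \<Rightarrow> ('d::finite) dop \<Rightarrow> 'd symb) \<Rightarrow> real \<Rightarrow> nat \<Rightarrow> 'd dop \<Rightarrow> nat \<Rightarrow> 'd dop" where
  "canonical_part \<sigma> \<nu> n \<Delta> k =
     quantise \<sigma> \<nu> (principal_symbol (n - k) (canonical_remainder \<sigma> \<nu> n \<Delta> k))"


section \<open>Pencil liftings\<close>

definition pencil_lifting :: "nat \<Rightarrow> real \<Rightarrow> (('d::finite) dop \<Rightarrow> 'd densop) \<Rightarrow> bool" where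
  "pencil_lifting n \<nu> L \<longleftrightarrow>
     (\<forall>A\<in>diff_ops n. \<forall>B\<in>diff_ops n. L (\<lambda>f. A f + B f) = (\<lambda>s. L A s + L B s)) \<and>
     (\<forall>c. \<forall>A\<in>diff_ops n. L (\<lambda>f. c *\<^sub>R A f) = (\<lambda>s. fmult (of_real c) (L A s))) \<and>
     (\<forall>A\<in>diff_ops n. L A \<in> all_weight_zero_ops \<and> restrict_weight (L A) \<nu> = A)"

definition regular_lifting :: "nat \<Rightarrow> (('d::finite) dop \<Rightarrow> 'd densop) \<Rightarrow> bool" where
  "regular_lifting n L \<longleftrightarrow> (\<forall>A\<in>diff_ops n. L A \<in> weight_zero_ops n)"

definition equivariant_lifting ::
  "('d::finite) vfield set \<Rightarrow> nat \<Rightarrow> real \<Rightarrow> ('d dop \<Rightarrow> 'd densop) \<Rightarrow> bool" where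
  "equivariant_lifting G n \<nu> L \<longleftrightarrow>
     (\<forall>K\<in>G. \<forall>A\<in>diff_ops n. ad_density K (L A) = L (ad_weight \<nu> K A))"

end

theory Submission
  imports Defs
begin

text \<open>
  The Casimir operator of \<open>proj(\<real>\<^sup>d)\<close> acts on symbols of degree \<open>k\<close> as the scalar \<open>2k(k + d)\<close>. These
  scalars are distinct, so the quantisation \<open>Q\<^sub>\<mu>(S)\<close> of a symbol \<open>S\<close> of degree \<open>k\<close> is the only operator of
  order \<open>k\<close> with principal symbol \<open>S\<close> that is an eigenvector of the Casimir operator of weight \<open>\<mu>\<close> for
  \<open>2k(k + d)\<close>. The adjoint turns weight \<open>\<mu>\<close> into \<open>1 - \<mu>\<close>, intertwines the Casimir operators, and multiplies
  principal symbols by \<open>(-1)\<^sup>k\<close>. Hence \<open>Q\<^sub>\<mu>(S)\<^sup>* = (-1)\<^sup>k Q\<^bsub>1-\<mu>\<^esub>(S)\<close>, and with \<open>P\<^sub>i(\<mu>) = (-1)\<^sup>i P\<^sub>i(1 - \<mu>)\<close>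
  every summand of the lifting acquires the sign \<open>(-1)\<^sup>i (-1)\<^bsup>n-i\<^esup> = (-1)\<^sup>n\<close>.
\<close>


section \<open>The algebra of smooth functions\<close>

text \<open>The map \<open>\<sigma> \<mu>\<close> is known only through
  \<open>full_symbol_map\<close>; no coefficient of the quantisation is ever computed. What
  transports is any expression in the operators \<open>ad_weight\<close> of the algebra:
  equivariance and linearity carry it to the same expression in Lie derivatives of symbols, and
  adjoints carry it to the same expression at weight 1 - \<mu>. Hence the Casimir element has to be
  evaluated on symbols only. It is the sum of E_ab E_ba over a, b = 0..d from gl(d+1), which acts by
  X_a d/dX_b in homogeneous coordinates: E_ij becomes x^i d_j, E_0j becomes d_j, E_i0 becomes -x^i E
  and E_00 becomes -E, with E the Euler field. This is the origin of the square of E and of the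
  factor -2. Two points lie outside this algebra. \<open>quantise\<close> is a bare inverse, so that
  it respects order and leading symbol needs an induction on the degree. Moving the eigenvalue
  equation to the adjoint needs uniqueness of adjoints, which rests on integration by parts and on
  one nonzero test function \<psi>, carried along as a hypothesis.\<close>

lemma fn_simps [simp]:
  "fn 0 x = 0" "fn 1 x = 1" "fn (a + b) x = fn a x + fn b x" "fn (a - b) x = fn a x - fn b x"
  "fn (- a) x = - fn a x" "fn (a * b) x = fn a x * fn b x" "fn (c *\<^sub>R a) x = c * fn a x"
  "fn (coord k) x = x $ k"
  by (transfer; simp)+

lemma fn_of_real [simp]: "fn (of_real c) x = c"
  by (simp add: of_real_def)

lemma fn_sum [simp]: "fn (sum a I) x = (\<Sum>i\<in>I. fn (a i) x)"
  by (induction I rule: infinite_finite_induct) auto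

lemma fn_prod_list [simp]: "fn (prod_list as) x = (\<Prod>a\<leftarrow>as. fn a x)"
  by (induction as) auto

lemma fn_power [simp]: "fn (a ^ k) x = fn a x ^ k"
  by (induction k) auto

lemma cinf_eqI: "(\<And>x. fn a x = fn b x) \<Longrightarrow> a = b"
  by (metis ext fn_inject)

lemma smooth_fn: "smooth (fn a)"
  using fn by auto

lemma smooth_differentiable: "smooth f \<Longrightarrow> f differentiable at x"
  by (metis smooth_def diff_times.simps(2))

lemma fn_differentiable: "fn a differentiable at x"
  by (rule smooth_differentiable[OF smooth_fn])

lemma fn_deriv_at: "fn (deriv_at i a) = pd i (fn a)"
  by transfer simp

lemma deriv_at_add [simp]: "deriv_at i (a + b) = deriv_at i a + deriv_at i b"
  by transfer (simp add: pd_add smooth_differentiable)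

lemma deriv_at_mult: "deriv_at i (a * b) = a * deriv_at i b + deriv_at i a * b"
  by transfer (simp add: pd_mult smooth_differentiable)

lemma deriv_at_of_real [simp]: "deriv_at i (of_real c) = 0"
  unfolding of_real_def by transfer (simp add: pd_const)

lemma deriv_at_scaleR [simp]: "deriv_at i (c *\<^sub>R a) = c *\<^sub>R deriv_at i a"
  using deriv_at_mult[of i "of_real c" a] by (simp add: scaleR_conv_of_real)

lemma deriv_at_0 [simp]: "deriv_at i 0 = 0"
  using deriv_at_of_real[of i 0] by simp

lemma deriv_at_1 [simp]: "deriv_at i 1 = 0"
  using deriv_at_of_real[of i 1] by simp

lemma deriv_at_uminus [simp]: "deriv_at i (- a) = - deriv_at i a"
  using deriv_at_scaleR[of i "-1" a] by simp

lemma deriv_at_diff [simp]: "deriv_at i (a - b) = deriv_at i a - deriv_at i b"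
  using deriv_at_add[of i a "- b"] by simp

lemma deriv_at_sum [simp]: "deriv_at i (sum a I) = (\<Sum>j\<in>I. deriv_at i (a j))"
  by (induction I rule: infinite_finite_induct) auto

lemma deriv_at_coord [simp]: "deriv_at i (coord k) = of_bool (i = k)"
proof (rule cinf_eqI)
  fix x
  have "((\<lambda>x::real^'a. x $ k) has_derivative (\<lambda>x. x $ k)) (at x)"
    by (rule bounded_linear_imp_has_derivative) (rule bounded_linear_vec_nth)
  then have "pd i (\<lambda>x::real^'a. x $ k) x = axis i 1 $ k"
    by (rule pd_eqI)
  moreover have "fn (coord k) = (\<lambda>x::real^'a. x $ k)"
    by (simp add: fun_eq_iff)
  ultimately show "fn (deriv_at i (coord k)) x = fn (of_bool (i = k)) x"
    by (simp add: fn_deriv_at axis_def)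
qed

lemma derivs_Nil [simp]: "derivs [] f = f"
  by (simp add: derivs_def)

lemma derivs_Cons [simp]: "derivs (i # is) f = deriv_at i (derivs is f)"
  by (simp add: derivs_def)

lemma derivs_add: "derivs is (f + g) = derivs is f + derivs is g"
  by (induction "is") auto

lemma derivs_scaleR: "derivs is (c *\<^sub>R f) = c *\<^sub>R derivs is f"
  by (induction "is") auto


section \<open>Principal symbols\<close>

text \<open>The description inside \<open>principal_symbol\<close> as a relation, usable before
  uniqueness is known. Here \<open>k\<close> only bounds the order, so \<open>S\<close> may
  vanish.\<close>

definition has_symbol :: "nat \<Rightarrow> ('d::finite) dop \<Rightarrow> 'd symb \<Rightarrow> bool" where
  "has_symbol k A S \<longleftrightarrow> (\<exists>a.
     A = (\<lambda>f. \<Sum>is | length is \<le> k. a is * derivs is f) \<and>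
     S = (\<lambda>x \<xi>. \<Sum>is | length is = k. fn (a is) x * (\<Prod>i\<leftarrow>is. \<xi> $ i)))"

lemma finite_length_le [simp]: "finite {is :: 'd::finite list. length is \<le> k}"
  using finite_lists_length_le[of "UNIV :: 'd set" k] by simp

lemma finite_length_eq [simp]: "finite {is :: 'd::finite list. length is = k}"
  by (rule finite_subset[OF _ finite_length_le[of k]]) auto

lemma finite_length_less [simp]: "finite {is :: 'd::finite list. length is < k}"
  by (rule finite_subset[OF _ finite_length_le[of k]]) auto

lemma diff_ops_iff: "A \<in> diff_ops k \<longleftrightarrow> (\<exists>S. has_symbol k A S)"
  by (auto simp: diff_ops_def has_symbol_def)

lemma has_symbol_diff_ops: "has_symbol k A S \<Longrightarrow> A \<in> diff_ops k"
  by (auto simp: diff_ops_iff)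

lemma has_symbol_add:
  assumes "has_symbol k A S" "has_symbol k B T"
  shows "has_symbol k (\<lambda>f. A f + B f) (\<lambda>x \<xi>. S x \<xi> + T x \<xi>)"
proof -
  obtain a b where
    "A = (\<lambda>f. \<Sum>is | length is \<le> k. a is * derivs is f)"
    "S = (\<lambda>x \<xi>. \<Sum>is | length is = k. fn (a is) x * (\<Prod>i\<leftarrow>is. \<xi> $ i))"
    "B = (\<lambda>f. \<Sum>is | length is \<le> k. b is * derivs is f)"
    "T = (\<lambda>x \<xi>. \<Sum>is | length is = k. fn (b is) x * (\<Prod>i\<leftarrow>is. \<xi> $ i))"
    using assms unfolding has_symbol_def by auto
  then show ?thesis
    unfolding has_symbol_def
    by (intro exI[of _ "\<lambda>is. a is + b is"]) (simp add: sum.distrib algebra_simps)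
qed

lemma has_symbol_times:
  assumes "has_symbol k A S"
  shows "has_symbol k (\<lambda>f. b * A f) (\<lambda>x \<xi>. fn b x * S x \<xi>)"
proof -
  obtain a where
    "A = (\<lambda>f. \<Sum>is | length is \<le> k. a is * derivs is f)"
    "S = (\<lambda>x \<xi>. \<Sum>is | length is = k. fn (a is) x * (\<Prod>i\<leftarrow>is. \<xi> $ i))"
    using assms unfolding has_symbol_def by auto
  then show ?thesis
    unfolding has_symbol_def
    by (intro exI[of _ "\<lambda>is. b * a is"]) (simp add: sum_distrib_left algebra_simps)
qed

lemma has_symbol_scaleR:
  "has_symbol k A S \<Longrightarrow> has_symbol k (\<lambda>f. c *\<^sub>R A f) (\<lambda>x \<xi>. c * S x \<xi>)"
  using has_symbol_times[of k A S "of_real c"] by (simp add: scaleR_conv_of_real)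

lemma has_symbol_0: "has_symbol k (\<lambda>f. 0) (\<lambda>x \<xi>. 0)"
  unfolding has_symbol_def by (intro exI[of _ "\<lambda>is. 0"]) simp

lemma has_symbol_sum:
  "(\<And>t. t \<in> I \<Longrightarrow> has_symbol k (A t) (S t)) \<Longrightarrow>
    has_symbol k (\<lambda>f. \<Sum>t\<in>I. A t f) (\<lambda>x \<xi>. \<Sum>t\<in>I. S t x \<xi>)"
  by (induction I rule: infinite_finite_induct) (auto simp: has_symbol_0 intro: has_symbol_add)

text \<open>Operators are finite sums of such monomials, so closure properties reduce to this case.
  A monomial with \<open>length js < k\<close> is invisible at order \<open>k\<close>.\<close>

lemma has_symbol_monomial:
  assumes "length js \<le> k"
  shows "has_symbol k (\<lambda>f. a * derivs js f)
    (\<lambda>x \<xi>. if length js = k then fn a x * (\<Prod>i\<leftarrow>js. \<xi> $ i) else 0)"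
proof -
  have 1: "(\<Sum>is | length is \<le> k. (if is = js then a else 0) * derivs is f) = a * derivs js f" for f
  proof -
    have "(\<Sum>is | length is \<le> k. (if is = js then a else 0) * derivs is f)
        = (\<Sum>is | length is \<le> k. if is = js then a * derivs is f else 0)"
      by (rule sum.cong) auto
    then show ?thesis
      using assms by (simp add: sum.delta)
  qed
  have 2: "(\<Sum>is | length is = k. fn (if is = js then a else 0) x * (\<Prod>i\<leftarrow>is. \<xi> $ i))
      = (if length js = k then fn a x * (\<Prod>i\<leftarrow>js. \<xi> $ i) else 0)" for x \<xi>
  proof -
    have "(\<Sum>is | length is = k. fn (if is = js then a else 0) x * (\<Prod>i\<leftarrow>is. \<xi> $ i))
        = (\<Sum>is | length is = k. if is = js then fn a x * (\<Prod>i\<leftarrow>is. \<xi> $ i) else 0)"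
      by (rule sum.cong) auto
    then show ?thesis
      by (simp add: sum.delta)
  qed
  show ?thesis
    unfolding has_symbol_def
    by (intro exI[of _ "\<lambda>is. if is = js then a else 0"] conjI) (simp_all only: 1 2)
qed

lemma has_symbol_mono:
  assumes "has_symbol k A S" "k \<le> l"
  shows "has_symbol l A (\<lambda>x \<xi>. if k = l then S x \<xi> else 0)"
proof (cases "k = l")
  case False
  obtain a where a: "A = (\<lambda>f. \<Sum>is | length is \<le> k. a is * derivs is f)"
    using assms unfolding has_symbol_def by auto
  have "has_symbol l (\<lambda>f. a is * derivs is f) (\<lambda>x \<xi>. 0)" if "length is \<le> k" for "is"
    using has_symbol_monomial[of "is" l "a is"] that assms False by simp
  then have "has_symbol l A (\<lambda>x \<xi>. \<Sum>is | length is \<le> k. 0)"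
    unfolding a using has_symbol_sum[of "{is. length is \<le> k}" l
        "\<lambda>is f. a is * derivs is f" "\<lambda>_ _ _. 0"]
    by simp
  then show ?thesis using False by simp
qed (use assms in simp)

lemma all_diff_opsI: "has_symbol k A S \<Longrightarrow> A \<in> all_diff_ops"
  using has_symbol_diff_ops by (auto simp: all_diff_ops_def)

lemma all_diff_opsE: 
  assumes "A \<in> all_diff_ops" obtains k S where "has_symbol k A S"
  using assms by (auto simp: all_diff_ops_def diff_ops_iff)

text \<open>In the product rule, the term that differentiates a coefficient has order at most
  \<open>k\<close> and is invisible at order \<open>Suc k\<close>.\<close>

lemma has_symbol_deriv_at:
  assumes "has_symbol k A S"
  shows "has_symbol (Suc k) (\<lambda>f. deriv_at i (A f)) (\<lambda>x \<xi>. \<xi> $ i * S x \<xi>)"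
proof -
  obtain a where a: "A = (\<lambda>f. \<Sum>is | length is \<le> k. a is * derivs is f)"
    and S: "S = (\<lambda>x \<xi>. \<Sum>is | length is = k. fn (a is) x * (\<Prod>i\<leftarrow>is. \<xi> $ i))"
    using assms unfolding has_symbol_def by auto
  have "has_symbol (Suc k) (\<lambda>f. a is * derivs (i # is) f + deriv_at i (a is) * derivs is f)
      (\<lambda>x \<xi>. if length is = k then \<xi> $ i * (fn (a is) x * (\<Prod>i\<leftarrow>is. \<xi> $ i)) else 0)"
    if "length is \<le> k" for "is"
    using has_symbol_add[OF has_symbol_monomial[of "i # is" "Suc k" "a is"]
        has_symbol_monomial[of "is" "Suc k" "deriv_at i (a is)"]] that
    by (simp add: algebra_simps cong: if_cong)
  then have "has_symbol (Suc k) (\<lambda>f. deriv_at i (A f)) (\<lambda>x \<xi>. \<Sum>is | length is \<le> k.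
      if length is = k then \<xi> $ i * (fn (a is) x * (\<Prod>i\<leftarrow>is. \<xi> $ i)) else 0)"
    unfolding a deriv_at_sum deriv_at_mult by (intro has_symbol_sum) simp
  moreover have "(\<Sum>is | length is \<le> k.
      if length is = k then \<xi> $ i * (fn (a is) x * (\<Prod>i\<leftarrow>is. \<xi> $ i)) else 0) = \<xi> $ i * S x \<xi>" for x \<xi>
    unfolding S sum_distrib_left
    by (rule sum.mono_neutral_cong_right) auto
  ultimately show ?thesis by simp
qed

lemma has_symbol_derivs:
  assumes "has_symbol k A S"
  shows "has_symbol (length is + k) (\<lambda>f. derivs is (A f)) (\<lambda>x \<xi>. (\<Prod>i\<leftarrow>is. \<xi> $ i) * S x \<xi>)"
proof (induction "is")
  case (Cons i "is")
  then show ?case using has_symbol_deriv_at[OF Cons, of i] by (simp add: mult.assoc)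
qed (use assms in simp)

text \<open>Derivatives of the coefficients of \<open>B\<close> enter in lower order only, so
  leading symbols multiply.\<close>

lemma has_symbol_comp:
  assumes "has_symbol k A S" "has_symbol l B T"
  shows "has_symbol (k + l) (\<lambda>f. A (B f)) (\<lambda>x \<xi>. S x \<xi> * T x \<xi>)"
proof -
  obtain a where a: "A = (\<lambda>f. \<Sum>is | length is \<le> k. a is * derivs is f)"
    and S: "S = (\<lambda>x \<xi>. \<Sum>is | length is = k. fn (a is) x * (\<Prod>i\<leftarrow>is. \<xi> $ i))"
    using assms unfolding has_symbol_def by auto
  have "has_symbol (k + l) (\<lambda>f. a is * derivs is (B f))
      (\<lambda>x \<xi>. if length is = k then fn (a is) x * (\<Prod>i\<leftarrow>is. \<xi> $ i) * T x \<xi> else 0)"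
    if "length is \<le> k" for "is"
    using has_symbol_mono[OF has_symbol_times[OF has_symbol_derivs[OF assms(2), of "is"], of "a is"],
        of "k + l"] that
    by (simp add: algebra_simps cong: if_cong)
  then have "has_symbol (k + l) (\<lambda>f. A (B f)) (\<lambda>x \<xi>. \<Sum>is | length is \<le> k.
      if length is = k then fn (a is) x * (\<Prod>i\<leftarrow>is. \<xi> $ i) * T x \<xi> else 0)"
    unfolding a by (intro has_symbol_sum) simp
  moreover have "(\<Sum>is | length is \<le> k.
      if length is = k then fn (a is) x * (\<Prod>i\<leftarrow>is. \<xi> $ i) * T x \<xi> else 0) = S x \<xi> * T x \<xi>" for x \<xi>
    unfolding S sum_distrib_right
    by (rule sum.mono_neutral_cong_right) auto
  ultimately show ?thesis by simp
qed

lemma has_symbol_fmult: "has_symbol 0 (\<lambda>f. a * f) (\<lambda>x \<xi>. fn a x)"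
  using has_symbol_monomial[of "[]" 0 a] by simp

lemma has_symbol_id: "has_symbol 0 (\<lambda>f. f) (\<lambda>x \<xi>. 1)"
  using has_symbol_fmult[of 1] by simp

text \<open>Applying an operator of order \<open>k\<close> to the \<open>k\<close>-th power of an affine function that vanishes at
  a point \<open>x\<close> reads off its principal symbol at \<open>x\<close>.\<close>

lemma derivs_affine_power:
  fixes \<xi> y :: "real^'d::finite"
  defines "l \<equiv> (\<Sum>i\<in>UNIV. (\<xi> $ i) *\<^sub>R (coord i - of_real (y $ i)))"
  assumes "length is \<le> k"
  shows "derivs is (l ^ k)
    = (fact k / fact (k - length is) * (\<Prod>i\<leftarrow>is. \<xi> $ i)) *\<^sub>R l ^ (k - length is)"
  using assms(2)
proof (induction "is")
  case (Cons i "is")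
  have l: "deriv_at i l = of_real (\<xi> $ i)"
    by (simp add: l_def of_bool_def if_distrib[where f="\<lambda>t. c *\<^sub>R t" for c] cong: if_cong)
      (simp add: scaleR_conv_of_real)
  have pow: "deriv_at i (l ^ Suc m) = (real (Suc m) * \<xi> $ i) *\<^sub>R l ^ m" for m
  proof (induction m)
    case (Suc m)
    then show ?case
      unfolding power_Suc[of l "Suc m"] deriv_at_mult Suc
      by (simp add: l scaleR_conv_of_real algebra_simps)
  qed (simp add: l scaleR_conv_of_real)
  obtain m where m: "k - length is = Suc m" "k - length (i # is) = m"
    using Cons.prems by (metis Suc_diff_Suc Suc_le_lessD length_Cons)
  show ?case
    using Cons pow[of m] unfolding m derivs_Cons
    by (simp add: m fact_Suc divide_simps del: power_Suc of_nat_Suc)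
qed simp

text \<open>The coefficients \<open>a is\<close> are not symmetric and in general not determined by
  \<open>A\<close>, so they cannot be compared. Instead the symbol is expressed through values of
  \<open>A\<close> alone.\<close>

lemma has_symbol_unique:
  assumes "has_symbol k A S" "has_symbol k A T"
  shows "S = T"
proof -
  have *: "R x \<xi> = fn (A ((\<Sum>i\<in>UNIV. (\<xi> $ i) *\<^sub>R (coord i - of_real (x $ i))) ^ k)) x / fact k"
    if R: "has_symbol k A R" for R x \<xi>
  proof -
    obtain a where a: "A = (\<lambda>f. \<Sum>is | length is \<le> k. a is * derivs is f)"
      and R: "R = (\<lambda>x \<xi>. \<Sum>is | length is = k. fn (a is) x * (\<Prod>i\<leftarrow>is. \<xi> $ i))"
      using R unfolding has_symbol_def by blast
    show ?thesis
      unfolding a R sum_divide_distrib fn_sum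
      by (rule sum.mono_neutral_cong_left) (auto simp: derivs_affine_power power_0_left)
  qed
  show ?thesis by (intro ext) (simp add: *[OF assms(1)] *[OF assms(2)])
qed

lemma principal_symbol_eq: "has_symbol k A S \<Longrightarrow> principal_symbol k A = S"
  unfolding principal_symbol_def has_symbol_def[symmetric]
  by (rule the_equality) (auto intro: has_symbol_unique)

section \<open>Linearity, and functions vanishing to high order at a point\<close>

lemma all_diff_ops_add_arg: "A \<in> all_diff_ops \<Longrightarrow> A (f + g) = A f + A g"
  by (auto simp: all_diff_ops_def diff_ops_def derivs_add algebra_simps sum.distrib)

lemma all_diff_ops_scaleR_arg: "A \<in> all_diff_ops \<Longrightarrow> A (c *\<^sub>R f) = c *\<^sub>R A f"
  by (auto simp: all_diff_ops_def diff_ops_def derivs_scaleR algebra_simps scaleR_sum_right)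

lemma all_diff_ops_0_arg: "A \<in> all_diff_ops \<Longrightarrow> A 0 = 0"
  using all_diff_ops_scaleR_arg[of A 0 0] by simp

text \<open>Each derivative costs at most one power of \<open>u\<close>. Only divisibility matters
  later, so the cofactor \<open>h\<close> stays unspecified.\<close>

lemma derivs_times_power: 
  "length is \<le> k \<Longrightarrow> \<exists>h. derivs is (g * u ^ k) = h * u ^ (k - length is)"
proof (induction "is")
  case (Cons i "is")
  then obtain h where h: "derivs is (g * u ^ k) = h * u ^ (k - length is)"
    by auto
  have pow: "deriv_at i (u ^ Suc m) = of_nat (Suc m) * deriv_at i u * u ^ m" for m
  proof (induction m)
    case (Suc m)
    then show ?case
      unfolding power_Suc[of u "Suc m"] deriv_at_mult Suc by (simp add: algebra_simps)
  qed simp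
  obtain m where m: "k - length is = Suc m" "k - length (i # is) = m"
    using Cons.prems by (metis Suc_diff_Suc Suc_le_lessD length_Cons)
  have "derivs (i # is) (g * u ^ k)
      = (h * of_nat (Suc m) * deriv_at i u + deriv_at i h * u) * u ^ m"
    unfolding derivs_Cons h m deriv_at_mult pow by (simp add: algebra_simps)
  then show ?case unfolding m by blast
qed auto

lemma diff_ops_times_power_vanish:
  assumes "A \<in> diff_ops k" "fn u x = 0"
  shows "fn (A (g * u ^ Suc k)) x = 0"
proof -
  obtain a where a: "A = (\<lambda>f. \<Sum>is | length is \<le> k. a is * derivs is f)"
    using assms unfolding diff_ops_def by auto
  have "fn (derivs is (g * u ^ Suc k)) x = 0" if le: "length is \<le> k" for "is"
  proof -
    obtain h where h: "derivs is (g * u ^ Suc k) = h * u ^ (Suc k - length is)"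
      using derivs_times_power[of "is" "Suc k" g u] le by (auto simp del: power_Suc)
    have "Suc k - length is \<noteq> 0" using le by auto
    then show ?thesis unfolding h using assms by simp
  qed
  then show ?thesis by (auto simp: a)
qed

section \<open>Compactly supported functions and formal adjoints\<close>

definition test_function :: "('d::finite) cinf \<Rightarrow> bool" where
  "test_function f \<longleftrightarrow> compact (closure {x. fn f x \<noteq> 0})"

lemma test_function_subset:
  assumes "test_function f" "{x. fn g x \<noteq> 0} \<subseteq> closure {x. fn f x \<noteq> 0}"
  shows "test_function g"
proof -
  have "closure {x. fn g x \<noteq> 0} \<subseteq> closure {x. fn f x \<noteq> 0}"
    using closure_minimal[OF assms(2)] by simp
  then show ?thesis
    using assms(1) compact_Int_closed[of "closure {x. fn f x \<noteq> 0}" "closure {x. fn g x \<noteq> 0}"]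
    unfolding test_function_def by (simp add: inf.absorb2)
qed

lemma test_function_times [intro]: "test_function f \<Longrightarrow> test_function (a * f)"
  by (erule test_function_subset) (rule order_trans[OF _ closure_subset], auto)

lemma test_function_times' [intro]: "test_function f \<Longrightarrow> test_function (f * a)"
  by (metis mult.commute test_function_times)

lemma test_function_add [intro]:
  assumes "test_function f" "test_function g" 
  shows "test_function (f + g)"
proof -
  have "closure {x. fn (f + g) x \<noteq> 0} \<subseteq> closure ({x. fn f x \<noteq> 0} \<union> {x. fn g x \<noteq> 0})"
    by (rule closure_mono) auto
  moreover have "compact (closure ({x. fn f x \<noteq> 0} \<union> {x. fn g x \<noteq> 0}))"
    using assms by (simp add: test_function_def closure_Un compact_Un)
  ultimately show ?thesis
    unfolding test_function_def
    by (metis closed_closure compact_Int_closed inf.absorb2)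
qed

lemma test_function_0 [intro, simp]: "test_function 0"
  by (simp add: test_function_def)

lemma test_function_sum [intro]:
  "(\<And>t. t \<in> I \<Longrightarrow> test_function (f t)) \<Longrightarrow> test_function (sum f I)"
  by (induction I rule: infinite_finite_induct) auto

lemma test_function_deriv_at [intro]:
  assumes "test_function f"
  shows "test_function (deriv_at i f)"
proof (rule test_function_subset[OF assms], rule subsetI, rule ccontr)
  fix x assume "x \<in> {x. fn (deriv_at i f) x \<noteq> 0}" and x: "x \<notin> closure {x. fn f x \<noteq> 0}"
  have "(fn f has_derivative (\<lambda>_. 0)) (at x)"
  proof (rule has_derivative_transform_within_open)
    show "((\<lambda>_. 0) has_derivative (\<lambda>_. 0)) (at x)" by simp
    show "open (- closure {x. fn f x \<noteq> 0})" by (intro open_Compl closed_closure)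
    show "x \<in> - closure {x. fn f x \<noteq> 0}" using x by simp
    show "0 = fn f y" if "y \<in> - closure {x. fn f x \<noteq> 0}" for y
      using that closure_subset[of "{x. fn f x \<noteq> 0}"] by auto
  qed
  then have "pd i (fn f) x = 0"
    by (rule pd_eqI)
  then show False
    using \<open>x \<in> {x. fn (deriv_at i f) x \<noteq> 0}\<close> by (simp add: fn_deriv_at)
qed

lemma test_function_diff_op:
  assumes "A \<in> all_diff_ops" "test_function f"
  shows "test_function (A f)"
proof -
  have "test_function (derivs is f)" for "is"
    using assms(2) by (induction "is") auto
  then show ?thesis
    using assms(1) unfolding all_diff_ops_def diff_ops_def by auto
qed

lemma continuous_on_fn: "continuous_on S (fn f)"
  by (intro differentiable_imp_continuous_on)
    (simp add: differentiable_on_def fn_differentiable differentiable_at_withinI)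

lemma borel_measurable_fn [measurable]: "fn f \<in> borel_measurable borel"
  by (intro borel_measurable_continuous_onI continuous_on_fn)

lemma integrable_test_function:
  assumes "test_function f"
  shows "integrable lborel (fn f)"
proof -
  have "integrable lborel (\<lambda>x. indicator (closure {x. fn f x \<noteq> 0}) x *\<^sub>R fn f x)"
    using assms by (intro borel_integrable_compact continuous_on_fn) (simp add: test_function_def)
  moreover have "(\<lambda>x. indicator (closure {x. fn f x \<noteq> 0}) x *\<^sub>R fn f x) = fn f"
    using closure_subset[of "{x. fn f x \<noteq> 0}"] by (auto simp: indicator_def fun_eq_iff)
  ultimately show ?thesis by simp
qed

lemma integrable_test_function_mult:
  assumes "test_function f"
  shows "integrable lborel (\<lambda>x. fn f x * fn g x)"
proof -
  have "fn (f * g) = (\<lambda>x. fn f x * fn g x)" by (rule ext) simp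
  then show ?thesis using integrable_test_function[OF test_function_times'[OF assms, of g]] by simp
qed

lemma DERIV_along_axis:
  "((\<lambda>s. fn f (x + s *\<^sub>R axis i 1)) has_real_derivative fn (deriv_at i f) (x + s *\<^sub>R axis i 1)) (at s)"
proof -
  let ?y = "x + s *\<^sub>R axis i 1"
  have D: "(fn f has_derivative frechet_derivative (fn f) (at ?y)) (at ?y)"
    by (rule pd_has[OF fn_differentiable])
  have "((\<lambda>s. x + s *\<^sub>R axis i (1::real)) has_derivative (\<lambda>t. t *\<^sub>R axis i 1)) (at s)"
    by (auto intro!: derivative_eq_intros)
  from has_derivative_compose[OF this D]
  have "((\<lambda>s. fn f (x + s *\<^sub>R axis i 1)) has_derivative
      (\<lambda>t. frechet_derivative (fn f) (at ?y) (t *\<^sub>R axis i 1))) (at s)" .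
  moreover have "frechet_derivative (fn f) (at ?y) (t *\<^sub>R axis i 1)
      = fn (deriv_at i f) ?y * t" for t
    using linear_cmul[OF linear_frechet_derivative[OF fn_differentiable], of f ?y t "axis i 1"]
    by (simp add: fn_deriv_at pd_def)
  ultimately show ?thesis
    by (simp add: has_field_derivative_def)
qed

text \<open>The integral of \<open>x \<mapsto> f(x + t e\<^sub>i)\<close> does not depend on \<open>t\<close>; differentiate at \<open>t = 0\<close>.\<close>

lemma integral_deriv_at:
  assumes "test_function f"
  shows "(\<integral>x. fn (deriv_at i f) x \<partial>lborel) = 0"
proof -
  define e :: "real^'a" where "e = axis i 1"
  define g where "g = fn (deriv_at i f)"
  \<comment> \<open>The increments form a sequence to suit dominated convergence; the bound 1 on
    them is what makes the radius \<open>r + 1\<close> suffice below.\<close>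
  define t :: "nat \<Rightarrow> real" where "t n = 1 / real (Suc n)" for n
  have t: "0 < t n" "t n \<le> 1" for n by (auto simp: t_def)
  have D: "((\<lambda>s. fn f (x + s *\<^sub>R e)) has_real_derivative g (x + s *\<^sub>R e)) (at s)" for x s
    unfolding e_def g_def by (rule DERIV_along_axis)
  define K where "K = closure {x. g x \<noteq> 0}"
  have K: "compact K"
    using test_function_deriv_at[OF assms, of i] unfolding K_def g_def test_function_def .
  have g0: "g x = 0" if "x \<notin> K" for x
    using that closure_subset[of "{x. g x \<noteq> 0}"] unfolding K_def by auto
  obtain r where r: "K \<subseteq> cball 0 r"
    using compact_imp_bounded[OF K] by (auto simp: bounded_iff subset_iff)
  have "bounded (g ` K)"
    by (intro compact_imp_bounded compact_continuous_image K) (simp add: g_def continuous_on_fn)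
  then obtain M where M: "M > 0" "\<And>x. x \<in> K \<Longrightarrow> \<bar>g x\<bar> \<le> M"
    unfolding bounded_pos by auto
  define Q where "Q n x = (fn f (x + t n *\<^sub>R e) - fn f x) / t n" for n x
  have lim: "(\<lambda>n. Q n x) \<longlonglongrightarrow> g x" for x
  proof -
    have "((\<lambda>h. (fn f (x + (0 + h) *\<^sub>R e) - fn f (x + 0 *\<^sub>R e)) / h) \<longlongrightarrow> g (x + 0 *\<^sub>R e)) (at 0)"
      using D[of x 0] unfolding DERIV_def .
    moreover have "filterlim t (at 0) sequentially"
      unfolding filterlim_at t_def using LIMSEQ_inverse_real_of_nat by (auto simp: inverse_eq_divide)
    ultimately show ?thesis
      unfolding Q_def by (auto dest: filterlim_compose)
  qed
  \<comment> \<open>By the mean value theorem \<open>Q n x\<close> is a value of \<open>g\<close> at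
    distance less than 1 from \<open>x\<close>. It vanishes unless that point lies in
    \<open>K\<close>, hence unless \<open>x\<close> lies in the ball of radius
    \<open>r + 1\<close>.\<close>
  have bound: "\<bar>Q n x\<bar> \<le> M * indicator (cball 0 (r + 1)) x" for n x
  proof -
    obtain z where z: "0 < z" "z < t n"
      "fn f (x + t n *\<^sub>R e) - fn f (x + 0 *\<^sub>R e) = (t n - 0) * g (x + z *\<^sub>R e)"
      using MVT2[of 0 "t n" "\<lambda>s. fn f (x + s *\<^sub>R e)" "\<lambda>s. g (x + s *\<^sub>R e)"] D t by blast
    then have Q: "Q n x = g (x + z *\<^sub>R e)"
      using t[of n] by (simp add: Q_def)
    show ?thesis
    proof (cases "x + z *\<^sub>R e \<in> K")
      case True
      have "norm x \<le> norm (x + z *\<^sub>R e) + norm (z *\<^sub>R e)"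
        by (metis add_diff_cancel norm_triangle_ineq4)
      moreover have "norm (z *\<^sub>R e) \<le> 1"
        using z t[of n] by (simp add: e_def)
      moreover have "norm (x + z *\<^sub>R e) \<le> r" using True r by auto
      ultimately show ?thesis using M(2)[OF True] Q by simp
    qed (use g0 Q M in simp)
  qed
  \<comment> \<open>Translation invariance of Lebesgue measure: both terms of the difference
    quotient have the same integral.\<close>
  have int0: "(\<integral>x. Q n x \<partial>lborel) = 0" for n
  proof -
    have 1: "integrable lborel (\<lambda>x. fn f (t n *\<^sub>R e + x))"
      using integrable_test_function[OF assms] lborel_distr_plus[of "t n *\<^sub>R e"]
      by (subst integrable_distr_eq[symmetric, where g = "(+) (t n *\<^sub>R e)" and N = borel]) auto
    have "(\<integral>x. fn f (t n *\<^sub>R e + x) \<partial>lborel) = (\<integral>x. fn f x \<partial>distr lborel borel ((+) (t n *\<^sub>R e)))"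
      by (rule integral_distr[symmetric]) auto
    then have "(\<integral>x. fn f (t n *\<^sub>R e + x) \<partial>lborel) = (\<integral>x. fn f x \<partial>lborel)"
      by (simp add: lborel_distr_plus)
    with 1 integrable_test_function[OF assms] show ?thesis
      by (simp add: Q_def add.commute)
  qed
  have "(\<lambda>n. \<integral>x. Q n x \<partial>lborel) \<longlonglongrightarrow> (\<integral>x. g x \<partial>lborel)"
  proof (rule integral_dominated_convergence)
    show "integrable lborel (\<lambda>x::real^'a. M * indicator (cball 0 (r + 1)) x)"
      by (intro integrable_mult_right integrable_real_indicator)
        (use emeasure_compact_finite[OF compact_cball, of "0 :: real^'a" "r + 1"] in auto)
    show "g \<in> borel_measurable lborel" "\<And>n. Q n \<in> borel_measurable lborel"
      unfolding g_def Q_def by measurable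
    show "AE x in lborel. (\<lambda>n. Q n x) \<longlonglongrightarrow> g x"
      using lim by simp
    show "\<And>n. AE x in lborel. norm (Q n x) \<le> M * indicator (cball 0 (r + 1)) x"
      using bound by simp
  qed
  then have "(\<lambda>n::nat. 0::real) \<longlonglongrightarrow> (\<integral>x. g x \<partial>lborel)"
    by (simp add: int0)
  then show ?thesis unfolding g_def using LIMSEQ_unique tendsto_const by blast
qed

section \<open>The pairing of coefficients and integration by parts\<close>

definition inner_L2 :: "('d::finite) cinf \<Rightarrow> 'd cinf \<Rightarrow> real" where
  "inner_L2 f g = (\<integral>x. fn f x * fn g x \<partial>lborel)"

lemma inner_L2_commute: "inner_L2 f g = inner_L2 g f"
  by (simp add: inner_L2_def mult.commute)

lemma inner_L2_mult_left: "inner_L2 (a * f) g = inner_L2 f (a * g)"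
  by (simp add: inner_L2_def mult_ac)

lemma inner_L2_scaleR [simp]:
  "inner_L2 (c *\<^sub>R f) g = c * inner_L2 f g" "inner_L2 f (c *\<^sub>R g) = c * inner_L2 f g"
  by (simp_all add: inner_L2_def mult.assoc mult.left_commute[of _ c])

lemma inner_L2_add_left:
  assumes "test_function f" "test_function g"
  shows "inner_L2 (f + g) h = inner_L2 f h + inner_L2 g h"
  using assms[THEN integrable_test_function_mult, of h]
  by (simp add: inner_L2_def distrib_right)

lemma inner_L2_add_right:
  "test_function f \<Longrightarrow> test_function g \<Longrightarrow> inner_L2 h (f + g) = inner_L2 h f + inner_L2 h g"
  using inner_L2_add_left inner_L2_commute by metis

lemma inner_L2_0 [simp]: "inner_L2 0 g = 0" "inner_L2 f 0 = 0"
  by (simp_all add: inner_L2_def)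

lemma inner_L2_deriv_at:
  assumes "test_function f" "test_function g"
  shows "inner_L2 (deriv_at i f) g = inner_L2 f (- deriv_at i g)"
proof -
  have "0 = (\<integral>x. fn (deriv_at i (f * g)) x \<partial>lborel)"
    using assms by (intro integral_deriv_at[symmetric]) auto
  also have "\<dots> = (\<integral>x. fn (f * deriv_at i g) x + fn (deriv_at i f * g) x \<partial>lborel)"
    by (simp add: deriv_at_mult)
  also have "\<dots> = (\<integral>x. fn (f * deriv_at i g) x \<partial>lborel) + (\<integral>x. fn (deriv_at i f * g) x \<partial>lborel)"
    using assms by (intro Bochner_Integration.integral_add integrable_test_function) auto
  finally show ?thesis by (simp add: inner_L2_def)
qed

text \<open>A continuous function that vanishes almost everywhere is zero, since a nonempty open set
  is not negligible.\<close>

lemma inner_L2_self_eq_0: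
  assumes "test_function f" "inner_L2 f f = 0"
  shows "f = 0"
proof (rule ccontr)
  assume "f \<noteq> 0"
  then have ne: "{x. fn f x \<noteq> 0} \<noteq> {}" by (metis (mono_tags) cinf_eqI empty_Collect_eq fn_simps(1))
  have op: "open {x. fn f x \<noteq> 0}"
    by (intro open_Collect_neq continuous_on_fn continuous_on_const)
  have "integrable lborel (\<lambda>x. fn f x * fn f x)"
    by (rule integrable_test_function_mult[OF assms(1)])
  then have "AE x in lborel. fn f x * fn f x = 0"
    using assms(2) unfolding inner_L2_def by (subst (asm) integral_nonneg_eq_0_iff_AE) auto
  then have "AE x in lborel. x \<notin> {x. fn f x \<noteq> 0}" by simp
  then have "{x. fn f x \<noteq> 0} \<in> null_sets lborel"
    using op by (subst (asm) AE_iff_null_sets[symmetric]) auto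
  then have "negligible {x. fn f x \<noteq> 0}"
    by (metis negligible_iff_null_sets null_sets_completionI)
  then show False using open_not_negligible[OF op ne] by simp
qed

text \<open>Weights are absent because densities of weights \<mu> and 1 - \<mu> pair by the L2
  product of their coefficients; \<open>A\<close> is read at weight \<mu>, \<open>B\<close> at
  weight 1 - \<mu>. Membership in \<open>all_diff_ops\<close> is included because it keeps supports
  compact under composition.\<close>

definition adj_pair :: "('d::finite) dop \<Rightarrow> 'd dop \<Rightarrow> bool" where
  "adj_pair A B \<longleftrightarrow> A \<in> all_diff_ops \<and> B \<in> all_diff_ops \<and>
     (\<forall>f g. test_function f \<longrightarrow> test_function g \<longrightarrow> inner_L2 (A f) g = inner_L2 f (B g))"

lemma adj_pair_times: "adj_pair (\<lambda>f. a * f) (\<lambda>f. a * f)"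
  unfolding adj_pair_def using has_symbol_fmult[THEN all_diff_opsI] by (auto simp: inner_L2_mult_left)

lemma all_diff_ops_add:
  "A \<in> all_diff_ops \<Longrightarrow> B \<in> all_diff_ops \<Longrightarrow> (\<lambda>f. A f + B f) \<in> all_diff_ops"
proof (elim all_diff_opsE)
  fix k l S T assume "has_symbol k A S" "has_symbol l B T"
  from has_symbol_mono[OF this(1), of "max k l"] has_symbol_mono[OF this(2), of "max k l"]
  show ?thesis by (simp add: has_symbol_add[THEN all_diff_opsI])
qed

lemma all_diff_ops_scaleR: "A \<in> all_diff_ops \<Longrightarrow> (\<lambda>f. c *\<^sub>R A f) \<in> all_diff_ops"
  by (elim all_diff_opsE) (rule all_diff_opsI[OF has_symbol_scaleR])

lemma all_diff_ops_uminus: "A \<in> all_diff_ops \<Longrightarrow> (\<lambda>f. - A f) \<in> all_diff_ops"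
  using all_diff_ops_scaleR[of A "-1"] by simp

lemma all_diff_ops_diff:
  "A \<in> all_diff_ops \<Longrightarrow> B \<in> all_diff_ops \<Longrightarrow> (\<lambda>f. A f - B f) \<in> all_diff_ops"
  using all_diff_ops_add[OF _ all_diff_ops_uminus] by fastforce

lemma all_diff_ops_comp:
  "A \<in> all_diff_ops \<Longrightarrow> B \<in> all_diff_ops \<Longrightarrow> (\<lambda>f. A (B f)) \<in> all_diff_ops"
  by (elim all_diff_opsE) (rule all_diff_opsI[OF has_symbol_comp])

lemma all_diff_ops_zero: "(\<lambda>f. 0) \<in> all_diff_ops"
  by (rule all_diff_opsI[OF has_symbol_0])

lemma all_diff_ops_sum:
  "(\<And>t. t \<in> I \<Longrightarrow> A t \<in> all_diff_ops) \<Longrightarrow> (\<lambda>f. \<Sum>t\<in>I. A t f) \<in> all_diff_ops"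
  by (induction I rule: infinite_finite_induct) (auto simp: all_diff_ops_zero intro: all_diff_ops_add)

lemma adj_pair_comp: "adj_pair A B \<Longrightarrow> adj_pair C D \<Longrightarrow> adj_pair (\<lambda>f. A (C f)) (\<lambda>f. D (B f))"
  unfolding adj_pair_def by (simp add: all_diff_ops_comp test_function_diff_op)

lemma adj_pair_add:
  "adj_pair A B \<Longrightarrow> adj_pair C D \<Longrightarrow> adj_pair (\<lambda>f. A f + C f) (\<lambda>f. B f + D f)"
  unfolding adj_pair_def
  by (auto simp: all_diff_ops_add inner_L2_add_left inner_L2_add_right test_function_diff_op)

lemma adj_pair_scaleR: "adj_pair A B \<Longrightarrow> adj_pair (\<lambda>f. c *\<^sub>R A f) (\<lambda>f. c *\<^sub>R B f)"
  unfolding adj_pair_def by (auto simp: all_diff_ops_scaleR)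

lemma adj_pair_uminus: "adj_pair A B \<Longrightarrow> adj_pair (\<lambda>f. - A f) (\<lambda>f. - B f)"
  using adj_pair_scaleR[of A B "-1"] by simp

lemma adj_pair_diff:
  "adj_pair A B \<Longrightarrow> adj_pair C D \<Longrightarrow> adj_pair (\<lambda>f. A f - C f) (\<lambda>f. B f - D f)"
  using adj_pair_add[OF _ adj_pair_uminus] by fastforce

lemma adj_pair_zero: "adj_pair (\<lambda>f. 0) (\<lambda>f. 0)"
  by (simp add: adj_pair_def all_diff_ops_zero)

lemma adj_pair_sum:
  "(\<And>t. t \<in> I \<Longrightarrow> adj_pair (A t) (B t)) \<Longrightarrow>
    adj_pair (\<lambda>f. \<Sum>t\<in>I. A t f) (\<lambda>f. \<Sum>t\<in>I. B t f)"
  by (induction I rule: infinite_finite_induct) (auto simp: adj_pair_zero intro: adj_pair_add)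

lemma adj_pair_deriv_at: "adj_pair (deriv_at i) (\<lambda>f. - deriv_at i f)"
proof -
  have "deriv_at i \<in> all_diff_ops"
    using has_symbol_deriv_at[OF has_symbol_id, of i] by (rule all_diff_opsI)
  then show ?thesis
    unfolding adj_pair_def by (auto intro: inner_L2_deriv_at all_diff_ops_uminus)
qed

text \<open>The adjoint composes the factors \<open>- deriv_at i\<close> in reverse order. Recording
  only its symbol, where factors commute, avoids any exchange of partial derivatives.\<close>

lemma adj_pair_derivs:
  "\<exists>B. has_symbol (length is) B (\<lambda>x \<xi>. (-1) ^ length is * (\<Prod>i\<leftarrow>is. \<xi> $ i)) \<and> adj_pair (derivs is) B"
proof (induction "is")
  case Nil
  then show ?case using adj_pair_times[of 1] has_symbol_id by (auto simp: derivs_def)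
next
  case (Cons i "is")
  then obtain B where B: "adj_pair (derivs is) B"
    "has_symbol (length is) B (\<lambda>x \<xi>. (-1) ^ length is * (\<Prod>i\<leftarrow>is. \<xi> $ i))" by auto
  have "adj_pair (derivs (i # is)) (\<lambda>f. B (- deriv_at i f))"
    using adj_pair_comp[OF adj_pair_deriv_at[of i] B(1)] by (simp add: derivs_Cons[abs_def])
  moreover have "has_symbol (length (i # is)) (\<lambda>f. B (- deriv_at i f))
      (\<lambda>x \<xi>. (-1) ^ length (i # is) * (\<Prod>i\<leftarrow>i # is. \<xi> $ i))"
    using has_symbol_comp[OF B(2) has_symbol_scaleR[OF has_symbol_deriv_at[OF has_symbol_id, of i], of "-1"]]
    by (simp add: mult_ac)
  ultimately show ?case by blast
qed

text \<open>Only monomials of length \<open>k\<close> reach the symbol of order \<open>k\<close>, so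
  the signs of the monomials collapse to one common sign.\<close>

lemma adj_pair_exists:
  fixes A :: "('d::finite) dop"
  assumes "has_symbol k A S"
  shows "\<exists>B. has_symbol k B (\<lambda>x \<xi>. (-1) ^ k * S x \<xi>) \<and> adj_pair A B"
proof -
  obtain a where a: "A = (\<lambda>f. \<Sum>is | length is \<le> k. a is * derivs is f)"
    and S: "S = (\<lambda>x \<xi>. \<Sum>is | length is = k. fn (a is) x * (\<Prod>i\<leftarrow>is. \<xi> $ i))"
    using assms unfolding has_symbol_def by auto
  obtain B where B: "\<And>is :: 'd list. has_symbol (length is) (B is) (\<lambda>x \<xi>. (-1) ^ length is * (\<Prod>i\<leftarrow>is. \<xi> $ i))"
    "\<And>is. adj_pair (derivs is) (B is)"
    using adj_pair_derivs by metis
  let ?B = "\<lambda>f. \<Sum>is | length is \<le> k. B is (a is * f)"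
  have "adj_pair A ?B"
    unfolding a by (intro adj_pair_sum adj_pair_comp[OF adj_pair_times] B)
  moreover have "has_symbol k ?B (\<lambda>x \<xi>. \<Sum>is | length is \<le> k. if length is = k
      then (-1) ^ length is * (\<Prod>i\<leftarrow>is. \<xi> $ i) * fn (a is) x else 0)"
    using has_symbol_mono[OF has_symbol_comp[OF B(1) has_symbol_fmult]]
    by (intro has_symbol_sum) (simp cong: if_cong)
  moreover have "(\<Sum>is | length is \<le> k. if length is = k
      then (-1) ^ length is * (\<Prod>i\<leftarrow>is. \<xi> $ i) * fn (a is) x else 0) = (-1) ^ k * S x \<xi>" for x \<xi>
    unfolding S sum_distrib_left by (rule sum.mono_neutral_cong_right) auto
  ultimately show ?thesis by auto
qed

text \<open>Integrating K^i d_i by parts adds minus the divergence, which turns the coefficient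
  \<mu> of the divergence into -(1 - \<mu>).\<close>

lemma adj_pair_lie_density: "adj_pair (lie_density K \<mu>) (\<lambda>f. - lie_density K (1 - \<mu>) f)"
proof -
  have "adj_pair (\<lambda>f. (\<Sum>i\<in>UNIV. K $ i * deriv_at i f) + \<mu> *\<^sub>R (divergence K * f))
    (\<lambda>f. (\<Sum>i\<in>UNIV. - deriv_at i (K $ i * f)) + \<mu> *\<^sub>R (divergence K * f))"
    by (intro adj_pair_add adj_pair_sum adj_pair_scaleR adj_pair_times
        adj_pair_comp[OF adj_pair_times] adj_pair_deriv_at)
  moreover have "(\<Sum>i\<in>UNIV. - deriv_at i (K $ i * f)) + \<mu> *\<^sub>R (divergence K * f)
      = - lie_density K (1 - \<mu>) f" for f
    by (simp add: lie_density_def divergence_def deriv_at_mult sum_negf sum_subtractf sum.distrib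
        sum_distrib_left sum_distrib_right algebra_simps)
  ultimately show ?thesis by (simp add: lie_density_def[abs_def])
qed

lemma lie_density_diff_op: "lie_density K \<mu> \<in> all_diff_ops"
  using adj_pair_lie_density[of K \<mu>] by (simp add: adj_pair_def)

lemma ad_weight_diff_op: "A \<in> all_diff_ops \<Longrightarrow> ad_weight \<mu> K A \<in> all_diff_ops"
  unfolding ad_weight_def
  by (rule all_diff_ops_diff[OF all_diff_ops_comp[OF lie_density_diff_op]
        all_diff_ops_comp[OF _ lie_density_diff_op]])

text \<open>Two signs cancel: the adjoint reverses the commutator, and the Lie derivative is
  anti-self-adjoint up to the change of weight.\<close>

lemma adj_pair_ad_weight:
  assumes "adj_pair A B"
  shows "adj_pair (ad_weight \<mu> K A) (ad_weight (1 - \<mu>) K B)"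
proof -
  have "adj_pair (ad_weight \<mu> K A)
      (\<lambda>f. B (- lie_density K (1 - \<mu>) f) - - lie_density K (1 - \<mu>) (B f))"
    unfolding ad_weight_def
    by (rule adj_pair_diff[OF adj_pair_comp[OF adj_pair_lie_density assms]
          adj_pair_comp[OF assms adj_pair_lie_density]])
  moreover have "B (- f) = - B f" for f
    using all_diff_ops_scaleR_arg[of B "-1" f] assms by (simp add: adj_pair_def)
  ultimately show ?thesis by (simp add: ad_weight_def)
qed

section \<open>Uniqueness of formal adjoints\<close>

lemma diff_times_shift: "diff_times k f \<Longrightarrow> diff_times k (\<lambda>x. f (x + v))"
proof (induction k arbitrary: f)
  case (Suc k)
  have D: "((\<lambda>x. f (x + v)) has_derivative frechet_derivative f (at (x + v))) (at x)" for x
  proof -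
    have "(f has_derivative frechet_derivative f (at (x + v))) (at (x + v))"
      using Suc.prems pd_has by auto
    moreover have "((\<lambda>x. x + v) has_derivative (\<lambda>x. x)) (at x)"
      by (auto intro!: derivative_eq_intros)
    ultimately show ?thesis using has_derivative_compose by fastforce
  qed
  have "pd i (\<lambda>x. f (x + v)) = (\<lambda>x. pd i f (x + v))" for i
    by (rule ext) (use pd_eqI[OF D] in \<open>simp add: pd_def\<close>)
  with Suc D show ?case by (auto simp: differentiable_def)
qed simp

text \<open>Translation makes a single nonzero test function serve at every point.\<close>

lemma test_function_nonzero_at:
  fixes f :: "('d::finite) cinf" and x :: "real^'d"
  assumes "test_function f" "f \<noteq> 0"
  obtains g where "test_function g" "fn g x \<noteq> 0"
proof -
  obtain y where y: "fn f y \<noteq> 0"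
    using assms(2) by (metis cinf_eqI fn_simps(1))
  define g where "g = Cinf (\<lambda>z. fn f (z + (y - x)))"
  have g: "fn g z = fn f (z + (y - x))" for z
    unfolding g_def
    by (subst Cinf_inverse) (use smooth_fn[of f] diff_times_shift in \<open>auto simp: smooth_def\<close>)
  have "{z. fn g z \<noteq> 0} = (+) (x - y) ` {z. fn f z \<noteq> 0}"
  proof (intro equalityI subsetI)
    fix z assume "z \<in> {z. fn g z \<noteq> 0}"
    then show "z \<in> (+) (x - y) ` {z. fn f z \<noteq> 0}"
      by (intro image_eqI[of _ _ "z + (y - x)"]) (auto simp: g)
  qed (auto simp: g)
  then have "closure {z. fn g z \<noteq> 0} = (+) (x - y) ` closure {z. fn f z \<noteq> 0}"
    by (simp add: closure_translation)
  then have "test_function g"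
    using assms(1) by (simp add: test_function_def compact_translation)
  moreover have "fn g x \<noteq> 0" using y by (simp add: g)
  ultimately show ?thesis using that by blast
qed

text \<open>A test function \<open>\<phi>\<close> with \<open>\<phi>(x) \<noteq> 0\<close> need not be \<open>1\<close> near \<open>x\<close>, but with \<open>u = 1 - \<phi>/\<phi>(x)\<close>
  the function \<open>1 - u\<^bsup>k+1\<^esup>\<close> is a multiple of \<open>\<phi>\<close> that agrees with \<open>1\<close> to order \<open>k\<close> at \<open>x\<close>.\<close>

lemma diff_op_eq_0:
  fixes A :: "('d::finite) dop" and \<psi> :: "'d cinf"
  assumes A: "A \<in> all_diff_ops" and A0: "\<And>f. test_function f \<Longrightarrow> A f = 0"
    and \<psi>: "test_function \<psi>" "\<psi> \<noteq> 0"
  shows "A f = 0"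
proof (rule cinf_eqI)
  fix x :: "real^'d"
  obtain k where k: "A \<in> diff_ops k" using A by (auto simp: all_diff_ops_def)
  obtain \<phi> where \<phi>: "test_function \<phi>" "fn \<phi> x \<noteq> 0"
    by (rule test_function_nonzero_at[OF \<psi>, of x])
  define u where "u = 1 - (1 / fn \<phi> x) *\<^sub>R \<phi>"
  have "1 - u ^ Suc k = (1 - u) * (\<Sum>i<Suc k. u ^ i)"
    by (rule one_diff_power_eq)
  also have "1 - u = of_real (1 / fn \<phi> x) * \<phi>"
    by (simp add: u_def scaleR_conv_of_real)
  finally have "test_function (f * (1 - u ^ Suc k))"
    using \<phi>(1) by (simp add: test_function_times test_function_times')
  then have "A (f * (1 - u ^ Suc k)) = 0" by (rule A0)
  moreover have "f = f * (1 - u ^ Suc k) + f * u ^ Suc k"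
    by (simp add: algebra_simps)
  ultimately have "A f = A (f * u ^ Suc k)"
    using all_diff_ops_add_arg[OF A, of "f * (1 - u ^ Suc k)" "f * u ^ Suc k"] by simp
  moreover have "fn u x = 0" using \<phi> by (simp add: u_def)
  ultimately show "fn (A f) x = fn 0 x"
    using diff_ops_times_power_vanish[OF k] by simp
qed

text \<open>The difference \<open>D\<close> is adjoint to zero; pairing \<open>D g\<close> with
  itself gives \<open>D g = 0\<close> for test functions \<open>g\<close>, and locality extends this
  to all functions. The function \<open>\<psi>\<close> ensures that the pairing carries
  information.\<close>

lemma adj_pair_unique:
  fixes A :: "('d::finite) dop" and \<psi> :: "'d cinf"
  assumes B: "adj_pair A B" and C: "adj_pair A C" and \<psi>: "test_function \<psi>" "\<psi> \<noteq> 0"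
  shows "B = C"
proof
  fix f
  define D where "D = (\<lambda>f. B f - C f)"
  have D: "adj_pair (\<lambda>f. 0) D"
    using adj_pair_diff[OF B C] by (simp add: D_def)
  then have D': "D \<in> all_diff_ops" by (simp add: adj_pair_def)
  have "D g = 0" if g: "test_function g" for g
  proof (rule inner_L2_self_eq_0)
    show Dg: "test_function (D g)" by (rule test_function_diff_op[OF D' g])
    show "inner_L2 (D g) (D g) = 0"
      using D Dg g unfolding adj_pair_def by auto
  qed
  then have "D f = 0" by (rule diff_op_eq_0[OF D' _ \<psi>])
  then show "B f = C f" by (simp add: D_def)
qed

section \<open>The Casimir operator of the projective algebra\<close>

text \<open>It is applied both to coefficients in x and to polynomials in the momenta, where its
  eigenvalue is the degree.\<close>

definition euler :: "('d::finite) cinf \<Rightarrow> 'd cinf" where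
  "euler a = (\<Sum>i\<in>UNIV. coord i * deriv_at i a)"

definition linear_field :: "'d \<Rightarrow> 'd \<Rightarrow> ('d::finite) vfield" where
  "linear_field k i = axis i (coord k)"

definition euler_field :: "('d::finite) vfield" where
  "euler_field = (\<chi> i. coord i)"

definition quadratic_field :: "'d \<Rightarrow> ('d::finite) vfield" where
  "quadratic_field k = (\<chi> i. coord k * coord i)"

lemma proj_algebra_generators [intro, simp]:
  "axis i 1 \<in> proj_algebra" "linear_field k i \<in> proj_algebra" "quadratic_field k \<in> proj_algebra"
  unfolding proj_algebra_def linear_field_def quadratic_field_def
  by (rule span_base; force)+

lemma euler_field_in_proj_algebra [intro, simp]: "euler_field \<in> proj_algebra"
proof -
  have "(\<Sum>i\<in>UNIV. linear_field i i) \<in> proj_algebra"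
    using proj_algebra_generators(2) unfolding proj_algebra_def by (rule span_sum)
  also have "(\<Sum>i\<in>UNIV. linear_field i i) = euler_field"
    by (simp add: vec_eq_iff euler_field_def linear_field_def axis_def if_distrib cong: if_cong)
  finally show ?thesis .
qed

text \<open>Both factors live in the ring of smooth functions, so the calculus of
  \<open>coord\<close> and \<open>deriv_at\<close> also serves for the momenta.\<close>

definition tensor :: "('d::finite) cinf \<Rightarrow> 'd cinf \<Rightarrow> 'd symb" where
  "tensor a m = (\<lambda>x \<xi>. fn a x * fn m \<xi>)"

lemma tensor_apply: "tensor a m x \<xi> = fn a x * fn m \<xi>"
  by (simp add: tensor_def)

text \<open>A class that contains the polynomial symbols and is stable under
  \<open>lie_symbol\<close>. It supplies the differentiability in x and in \<xi> without which
  \<open>lie_symbol\<close> need not be additive.\<close>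

inductive tensor_symbol :: "('d::finite) symb \<Rightarrow> bool" where
  tensor: "tensor_symbol (tensor a m)"
| add: "tensor_symbol F \<Longrightarrow> tensor_symbol G \<Longrightarrow> tensor_symbol (\<lambda>x \<xi>. F x \<xi> + G x \<xi>)"

lemma tensor_symbol_scale: "tensor_symbol F \<Longrightarrow> tensor_symbol (\<lambda>x \<xi>. c * F x \<xi>)"
proof (induction rule: tensor_symbol.induct)
  case (tensor a m)
  have "(\<lambda>x \<xi>. c * tensor a m x \<xi>) = tensor (c *\<^sub>R a) m"
    by (simp add: tensor_def mult.assoc)
  then show ?case by (simp add: tensor_symbol.tensor)
qed (simp add: distrib_left tensor_symbol.add)

lemma tensor_symbol_diff:
  "tensor_symbol F \<Longrightarrow> tensor_symbol G \<Longrightarrow> tensor_symbol (\<lambda>x \<xi>. F x \<xi> - G x \<xi>)"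
  using tensor_symbol.add[OF _ tensor_symbol_scale, of F G "-1"] by simp

lemma tensor_symbol_0: "tensor_symbol (\<lambda>x \<xi>. 0)"
  using tensor_symbol.tensor[of 0 0] by (simp add: tensor_def)

lemma tensor_symbol_sum:
  "(\<And>t. t \<in> I \<Longrightarrow> tensor_symbol (F t)) \<Longrightarrow> tensor_symbol (\<lambda>x \<xi>. \<Sum>t\<in>I. F t x \<xi>)"
  by (induction I rule: infinite_finite_induct) (auto simp: tensor_symbol_0 intro: tensor_symbol.add)

lemma tensor_symbol_slices:
  assumes "tensor_symbol F"
  shows "\<exists>a. (\<lambda>y. F y \<xi>) = fn a" "\<exists>m. F x = fn m"
proof -
  show "\<exists>a. (\<lambda>y. F y \<xi>) = fn a"
    using assms
  proof induction
    case (tensor a m)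
    have "(\<lambda>y. tensor a m y \<xi>) = fn (a * of_real (fn m \<xi>))"
      by (simp add: tensor_def fun_eq_iff)
    then show ?case ..
  next
    case (add F G)
    then obtain a b where "(\<lambda>y. F y \<xi>) = fn a" "(\<lambda>y. G y \<xi>) = fn b" by auto
    then have "(\<lambda>y. F y \<xi> + G y \<xi>) = fn (a + b)" by (simp add: fun_eq_iff)
    then show ?case ..
  qed
  show "\<exists>m. F x = fn m"
    using assms
  proof induction
    case (tensor a m)
    have "tensor a m x = fn (of_real (fn a x) * m)"
      by (simp add: tensor_def fun_eq_iff)
    then show ?case ..
  next
    case (add F G)
    then obtain a b where "F x = fn a" "G x = fn b" by auto
    then have "(\<lambda>\<xi>. F x \<xi> + G x \<xi>) = fn (a + b)" by (simp add: fun_eq_iff)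
    then show ?case ..
  qed
qed

section \<open>Lie derivatives of symbols along the generators\<close>

lemma lie_symbol_add:
  assumes "tensor_symbol F" "tensor_symbol G"
  shows "lie_symbol K (\<lambda>x \<xi>. F x \<xi> + G x \<xi>) = (\<lambda>x \<xi>. lie_symbol K F x \<xi> + lie_symbol K G x \<xi>)"
proof (intro ext)
  fix x \<xi>
  have 1: "pd i (\<lambda>y. F y \<xi> + G y \<xi>) x = pd i (\<lambda>y. F y \<xi>) x + pd i (\<lambda>y. G y \<xi>) x" for i
  proof -
    obtain a b where "(\<lambda>y. F y \<xi>) = fn a" "(\<lambda>y. G y \<xi>) = fn b"
      using assms tensor_symbol_slices(1) by blast
    then have "pd i (\<lambda>y. F y \<xi> + G y \<xi>) = (\<lambda>y. pd i (\<lambda>y. F y \<xi>) y + pd i (\<lambda>y. G y \<xi>) y)"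
      by (intro pd_add) (simp_all add: fn_differentiable)
    then show ?thesis by simp
  qed
  have 2: "pd i (\<lambda>\<eta>. F x \<eta> + G x \<eta>) \<xi> = pd i (F x) \<xi> + pd i (G x) \<xi>" for i
  proof -
    obtain a b where "F x = fn a" "G x = fn b"
      using assms tensor_symbol_slices(2) by blast
    then have "pd i (\<lambda>\<eta>. F x \<eta> + G x \<eta>) = (\<lambda>\<eta>. pd i (F x) \<eta> + pd i (G x) \<eta>)"
      by (intro pd_add) (simp_all add: fn_differentiable)
    then show ?thesis by simp
  qed
  show "lie_symbol K (\<lambda>x \<xi>. F x \<xi> + G x \<xi>) x \<xi> = lie_symbol K F x \<xi> + lie_symbol K G x \<xi>"
    by (simp add: lie_symbol_def 1 2 sum.distrib algebra_simps)
qed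

lemma lie_symbol_tensor_pointwise:
  "lie_symbol K (tensor a m) x \<xi> = (\<Sum>i\<in>UNIV. fn (K $ i) x * fn (deriv_at i a) x) * fn m \<xi>
    - (\<Sum>i\<in>UNIV. \<Sum>j\<in>UNIV. fn (deriv_at j (K $ i)) x * (fn a x * (\<xi> $ i * fn (deriv_at j m) \<xi>)))"
proof -
  have 1: "pd i (\<lambda>y. tensor a m y \<xi>) x = fn (deriv_at i a) x * fn m \<xi>" for i
  proof -
    have "(\<lambda>y. tensor a m y \<xi>) = fn (of_real (fn m \<xi>) * a)"
      by (simp add: tensor_def fun_eq_iff)
    then show ?thesis by (simp add: fn_deriv_at[symmetric] deriv_at_mult)
  qed
  have 2: "pd i (tensor a m x) \<xi> = fn a x * fn (deriv_at i m) \<xi>" for i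
  proof -
    have "tensor a m x = fn (of_real (fn a x) * m)"
      by (simp add: tensor_def fun_eq_iff)
    then show ?thesis by (simp add: fn_deriv_at[symmetric] deriv_at_mult)
  qed
  show ?thesis
    unfolding lie_symbol_def 1 2 by (simp add: sum_distrib_left sum_distrib_right mult_ac)
qed

lemma lie_symbol_scale:
  assumes "tensor_symbol F"
  shows "lie_symbol K (\<lambda>x \<xi>. c * F x \<xi>) = (\<lambda>x \<xi>. c * lie_symbol K F x \<xi>)"
  using assms
proof induction
  case (tensor a m)
  have 1: "(\<lambda>x \<xi>. c * tensor a m x \<xi>) = tensor (c *\<^sub>R a) m"
    by (simp add: tensor_def mult.assoc)
  show ?case unfolding 1
    by (simp add: lie_symbol_tensor_pointwise fun_eq_iff sum_distrib_left algebra_simps)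
qed (simp add: distrib_left lie_symbol_add tensor_symbol_scale)

lemma lie_symbol_diff:
  "tensor_symbol F \<Longrightarrow> tensor_symbol G \<Longrightarrow>
    lie_symbol K (\<lambda>x \<xi>. F x \<xi> - G x \<xi>) = (\<lambda>x \<xi>. lie_symbol K F x \<xi> - lie_symbol K G x \<xi>)"
  using lie_symbol_add[OF _ tensor_symbol_scale, of F G K "-1"] lie_symbol_scale[of G K "-1"]
  by simp

lemma tensor_symbol_lie:
  assumes "tensor_symbol F"
  shows "tensor_symbol (lie_symbol K F)"
  using assms
proof induction
  case (tensor a m)
  have "lie_symbol K (tensor a m) = (\<lambda>x \<xi>. tensor (\<Sum>i\<in>UNIV. K $ i * deriv_at i a) m x \<xi>
      - (\<Sum>i\<in>UNIV. \<Sum>j\<in>UNIV. tensor (deriv_at j (K $ i) * a) (coord i * deriv_at j m) x \<xi>))"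
    by (simp add: fun_eq_iff lie_symbol_tensor_pointwise tensor_apply mult_ac)
  then show ?case
    by (simp add: tensor_symbol_diff tensor_symbol_sum tensor_symbol.tensor)
qed (simp add: lie_symbol_add tensor_symbol.add)

lemma sum_of_bool_times:
  "finite I \<Longrightarrow> (\<Sum>j\<in>I. of_bool (j = k) * f j) = (if k \<in> I then f k else (0 :: 'a :: semiring_1))"
  "finite I \<Longrightarrow> (\<Sum>j\<in>I. of_bool (k = j) * f j) = (if k \<in> I then f k else (0 :: 'a :: semiring_1))"
  by (simp_all add: of_bool_def if_distrib[where f = "\<lambda>t. t * c" for c] cong: if_cong)

lemma fn_of_bool [simp]: "fn (of_bool P) x = of_bool P"
  by simp

lemma lie_symbol_translation:
  "lie_symbol (axis i 1) (tensor a m) = tensor (deriv_at i a) m"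
proof -
  have "axis i (1 :: 'a cinf) $ j = of_bool (j = i)" for j
    by (simp add: axis_def)
  moreover have "deriv_at k (of_bool P) = 0" for k :: 'a and P by simp
  ultimately show ?thesis
    by (simp add: fun_eq_iff lie_symbol_tensor_pointwise tensor_apply sum_of_bool_times
        del: of_bool_eq_iff)
qed

lemma lie_symbol_linear:
  "lie_symbol (linear_field k i) (tensor a m)
    = (\<lambda>x \<xi>. tensor (coord k * deriv_at i a) m x \<xi> - tensor a (coord i * deriv_at k m) x \<xi>)"
proof -
  have 1: "linear_field k i $ j = of_bool (j = i) * coord k" for j
    by (simp add: linear_field_def axis_def)
  have 2: "deriv_at l (of_bool P * coord k) = of_bool P * of_bool (l = k)" for l P
    by (cases P) simp_all
  show ?thesis
    by (simp add: fun_eq_iff lie_symbol_tensor_pointwise tensor_apply 1 2 sum_of_bool_times mult.assoc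
        sum_distrib_left[symmetric] del: of_bool_eq_iff)
qed

lemma lie_symbol_euler:
  "lie_symbol euler_field (tensor a m) = (\<lambda>x \<xi>. tensor (euler a) m x \<xi> - tensor a (euler m) x \<xi>)"
  by (simp add: fun_eq_iff lie_symbol_tensor_pointwise tensor_apply euler_field_def euler_def
      sum_of_bool_times sum_distrib_left[symmetric] del: of_bool_eq_iff)

lemma lie_symbol_quadratic:
  "lie_symbol (quadratic_field k) (tensor a m) = (\<lambda>x \<xi>. tensor (coord k * euler a) m x \<xi>
    - (\<Sum>j\<in>UNIV. tensor (coord j * a) (coord j * deriv_at k m) x \<xi>)
    - tensor (coord k * a) (euler m) x \<xi>)"
proof -
  have 1: "(\<Sum>j\<in>UNIV. fn (deriv_at j (quadratic_field k $ i)) x * (fn a x * (\<xi> $ i * fn (deriv_at j m) \<xi>)))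
      = x $ i * fn a x * (\<xi> $ i * fn (deriv_at k m) \<xi>) + x $ k * fn a x * (\<xi> $ i * fn (deriv_at i m) \<xi>)"
    for i x \<xi>
    by (simp add: quadratic_field_def deriv_at_mult distrib_right sum.distrib mult.assoc
        mult.left_commute[of _ "of_bool b" for b] sum_of_bool_times del: of_bool_eq_iff)
  have 2: "quadratic_field k $ i = coord k * coord i" for i
    by (simp add: quadratic_field_def)
  show ?thesis
    by (simp add: fun_eq_iff lie_symbol_tensor_pointwise tensor_apply 1 sum.distrib)
      (simp add: 2 euler_def sum_distrib_left mult_ac)
qed

text \<open>In the Casimir element the products \<open>L(\<partial>\<^sub>i) L(x\<^sup>i E) + L(x\<^sup>i E) L(\<partial>\<^sub>i)\<close>, with \<open>E\<close> the Euler field, are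
  reordered so that the translations act first; since \<open>\<Sum>\<^sub>i [\<partial>\<^sub>i, x\<^sup>i E] = (d + 1) E\<close>, this produces the
  linear term \<open>-(d + 1) L(E)\<close>.\<close>

definition casimir_symbol :: "('d::finite) symb \<Rightarrow> 'd symb" where
  "casimir_symbol F = (\<lambda>x \<xi>.
     (\<Sum>i\<in>UNIV. \<Sum>j\<in>UNIV. lie_symbol (linear_field i j) (lie_symbol (linear_field j i) F) x \<xi>)
     + lie_symbol euler_field (lie_symbol euler_field F) x \<xi>
     + - (real CARD('d) + 1) * lie_symbol euler_field F x \<xi>
     + (-2) * (\<Sum>i\<in>UNIV. lie_symbol (quadratic_field i) (lie_symbol (axis i 1) F) x \<xi>))"

lemma euler_euler:
  "(\<Sum>i\<in>UNIV. coord i * euler (deriv_at i a)) = euler (euler a) - euler a"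
proof -
  have "euler (euler a) = euler a + (\<Sum>i\<in>UNIV. \<Sum>j\<in>UNIV. coord i * (coord j * deriv_at i (deriv_at j a)))"
    by (simp add: euler_def deriv_at_mult sum.distrib distrib_left sum_distrib_left sum_of_bool_times
        del: of_bool_eq_iff)
  \<comment> \<open>Only the summation indices trade places; the order of the two derivatives is
    kept.\<close>
  also have "(\<Sum>i\<in>UNIV. \<Sum>j\<in>UNIV. coord i * (coord j * deriv_at i (deriv_at j a)))
      = (\<Sum>i\<in>UNIV. coord i * euler (deriv_at i a))"
    by (subst sum.swap) (simp add: euler_def sum_distrib_left mult_ac)
  finally show ?thesis by simp
qed

text \<open>The quadratic Casimir of gl(d) on functions: moving \<open>coord j\<close> out past
  \<open>deriv_at j\<close> and summing over \<open>j\<close> produces d, and the second-order rest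
  is \<open>euler_euler\<close>.\<close>

lemma sum_linear_linear:
  fixes a :: "('d::finite) cinf"
  shows "(\<Sum>i\<in>UNIV. \<Sum>j\<in>UNIV. coord i * deriv_at j (coord j * deriv_at i a))
    = euler (euler a) + (real CARD('d) - 1) *\<^sub>R euler a"
proof -
  have "(\<Sum>j\<in>UNIV. coord i * deriv_at j (coord j * deriv_at i a))
      = real CARD('d) *\<^sub>R (coord i * deriv_at i a) + coord i * euler (deriv_at i a)" for i
    by (simp add: deriv_at_mult euler_def distrib_left sum.distrib sum_distrib_left scaleR_conv_of_real)
  then show ?thesis
    by (simp add: sum.distrib euler_euler scaleR_sum_right[symmetric] euler_def[of a, symmetric] algebra_simps)
qed

text \<open>All terms that differentiate \<open>a\<close> cancel. The mixed terms \<open>H\<close>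
  occur with factor -2 from the linear fields and +2 from the quadratic ones;
  \<open>euler (euler a)\<close> occurs with factors 1, 1 and -2. What survives are the terms in
  \<open>k\<close> alone: k^2 + (d - 1)k, k^2 and (d + 1)k.\<close>

lemma casimir_symbol_tensor:
  fixes a m :: "('d::finite) cinf"
  assumes m: "euler m = k *\<^sub>R m"
  shows "casimir_symbol (tensor a m) = (\<lambda>x \<xi>. 2 * k * (k + real CARD('d)) * tensor a m x \<xi>)"
proof (intro ext)
  fix x \<xi> :: "real^'d"
  have lin: "lie_symbol (linear_field i j) (lie_symbol (linear_field j i) (tensor a m)) x \<xi>
      = fn (coord i * deriv_at j (coord j * deriv_at i a)) x * fn m \<xi>
        - fn (coord j * deriv_at i a) x * fn (coord j * deriv_at i m) \<xi>
        - fn (coord i * deriv_at j a) x * fn (coord i * deriv_at j m) \<xi>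
        + fn a x * fn (coord j * deriv_at i (coord i * deriv_at j m)) \<xi>" for i j
    unfolding lie_symbol_linear[of j i] lie_symbol_diff[OF tensor_symbol.tensor tensor_symbol.tensor]
      lie_symbol_linear by (simp add: tensor_def)
  define H where "H = (\<Sum>i\<in>UNIV. \<Sum>j\<in>UNIV. fn (coord j * deriv_at i a) x * fn (coord j * deriv_at i m) \<xi>)"
  have H': "(\<Sum>i\<in>UNIV. \<Sum>j\<in>UNIV. fn (coord i * deriv_at j a) x * fn (coord i * deriv_at j m) \<xi>) = H"
    unfolding H_def by (rule sum.swap)
  have 1: "(\<Sum>i\<in>UNIV. \<Sum>j\<in>UNIV. fn (coord i * deriv_at j (coord j * deriv_at i a)) x * fn m \<xi>)
      = fn (euler (euler a) + (real CARD('d) - 1) *\<^sub>R euler a) x * fn m \<xi>"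
    unfolding sum_linear_linear[symmetric] fn_sum sum_distrib_right ..
  have "(\<Sum>i\<in>UNIV. \<Sum>j\<in>UNIV. fn a x * fn (coord j * deriv_at i (coord i * deriv_at j m)) \<xi>)
      = fn a x * fn (euler (euler m) + (real CARD('d) - 1) *\<^sub>R euler m) \<xi>"
    unfolding sum_linear_linear[symmetric] fn_sum sum_distrib_left by (rule sum.swap)
  also have "\<dots> = fn a x * ((k * k + (real CARD('d) - 1) * k) * fn m \<xi>)"
  proof -
    have "euler (k *\<^sub>R m) = k *\<^sub>R euler m"
      by (simp add: euler_def scaleR_sum_right)
    then show ?thesis by (simp add: m algebra_simps)
  qed
  finally have 2: "(\<Sum>i\<in>UNIV. \<Sum>j\<in>UNIV. fn a x * fn (coord j * deriv_at i (coord i * deriv_at j m)) \<xi>)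
      = fn a x * ((k * k + (real CARD('d) - 1) * k) * fn m \<xi>)" .
  have L: "(\<Sum>i\<in>UNIV. \<Sum>j\<in>UNIV. lie_symbol (linear_field i j) (lie_symbol (linear_field j i) (tensor a m)) x \<xi>)
      = fn (euler (euler a) + (real CARD('d) - 1) *\<^sub>R euler a) x * fn m \<xi> - 2 * H
        + fn a x * ((k * k + (real CARD('d) - 1) * k) * fn m \<xi>)"
    unfolding lin sum.distrib sum_subtractf 1 2 H' H_def[symmetric] by simp
  have E: "lie_symbol euler_field (tensor b m) = tensor (euler b - k *\<^sub>R b) m" for b
    unfolding lie_symbol_euler by (simp add: m tensor_def fun_eq_iff algebra_simps)
  have EE: "lie_symbol euler_field (lie_symbol euler_field (tensor a m)) x \<xi>
      = (fn (euler (euler a)) x - 2 * k * fn (euler a) x + k * k * fn a x) * fn m \<xi>"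
  proof -
    have "euler (euler a - k *\<^sub>R a) = euler (euler a) - k *\<^sub>R euler a"
      unfolding euler_def[of "euler a - k *\<^sub>R a"] euler_def[of "euler a"]
      by (simp add: right_diff_distrib sum_subtractf scaleR_sum_right[symmetric] euler_def[of a, symmetric])
    then show ?thesis unfolding E by (simp add: tensor_apply left_diff_distrib) (simp add: algebra_simps)
  qed
  have "lie_symbol (quadratic_field i) (lie_symbol (axis i 1) (tensor a m)) x \<xi>
      = fn (coord i * euler (deriv_at i a)) x * fn m \<xi>
        - (\<Sum>j\<in>UNIV. fn (coord j * deriv_at i a) x * fn (coord j * deriv_at i m) \<xi>)
        - fn (coord i * deriv_at i a) x * (k * fn m \<xi>)" for i
    unfolding lie_symbol_translation lie_symbol_quadratic by (simp add: tensor_def m)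
  then have "(\<Sum>i\<in>UNIV. lie_symbol (quadratic_field i) (lie_symbol (axis i 1) (tensor a m)) x \<xi>)
      = (\<Sum>i\<in>UNIV. fn (coord i * euler (deriv_at i a)) x) * fn m \<xi> - H
        - (\<Sum>i\<in>UNIV. fn (coord i * deriv_at i a) x) * (k * fn m \<xi>)"
    by (simp only: sum_subtractf sum_distrib_right H_def)
  also have "\<dots> = (fn (euler (euler a)) x - fn (euler a) x) * fn m \<xi> - H - fn (euler a) x * (k * fn m \<xi>)"
    unfolding fn_sum[symmetric] euler_euler euler_def[of a, symmetric] by simp
  finally have T: "(\<Sum>i\<in>UNIV. lie_symbol (quadratic_field i) (lie_symbol (axis i 1) (tensor a m)) x \<xi>)
      = (fn (euler (euler a)) x - fn (euler a) x) * fn m \<xi> - H - fn (euler a) x * (k * fn m \<xi>)" .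
  show "casimir_symbol (tensor a m) x \<xi> = 2 * k * (k + real CARD('d)) * tensor a m x \<xi>"
    unfolding casimir_symbol_def L EE T unfolding E
    by (simp add: tensor_def algebra_simps)
qed

lemma casimir_symbol_add:
  assumes "tensor_symbol F" "tensor_symbol G"
  shows "casimir_symbol (\<lambda>x \<xi>. F x \<xi> + G x \<xi>) = (\<lambda>x \<xi>. casimir_symbol F x \<xi> + casimir_symbol G x \<xi>)"
  unfolding casimir_symbol_def lie_symbol_add[OF assms]
    lie_symbol_add[OF assms[THEN tensor_symbol_lie]] sum.distrib
  by (simp add: algebra_simps)

lemma casimir_symbol_scale:
  assumes "tensor_symbol F"
  shows "casimir_symbol (\<lambda>x \<xi>. c * F x \<xi>) = (\<lambda>x \<xi>. c * casimir_symbol F x \<xi>)"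
  unfolding casimir_symbol_def lie_symbol_scale[OF assms] lie_symbol_scale[OF assms[THEN tensor_symbol_lie]]
    sum_distrib_left[symmetric]
  by (simp add: algebra_simps)

lemma casimir_symbol_sum:
  assumes "\<And>t. t \<in> I \<Longrightarrow> tensor_symbol (F t)"
  shows "casimir_symbol (\<lambda>x \<xi>. \<Sum>t\<in>I. F t x \<xi>) = (\<lambda>x \<xi>. \<Sum>t\<in>I. casimir_symbol (F t) x \<xi>)"
  using assms
proof (induction I rule: infinite_finite_induct)
  case (insert t I)
  then show ?case
    by (simp add: casimir_symbol_add tensor_symbol_sum)
qed (use casimir_symbol_scale[OF tensor_symbol_0, of 0] in simp_all)

section \<open>Separation of degrees by the Casimir eigenvalues\<close>

definition casimir_eigenvalue :: "'d::finite itself \<Rightarrow> nat \<Rightarrow> real" where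
  "casimir_eigenvalue _ k = 2 * real k * (real k + real CARD('d))"

lemma casimir_eigenvalue_less:
  "k < l \<Longrightarrow> casimir_eigenvalue TYPE('d::finite) k < casimir_eigenvalue TYPE('d) l"
  unfolding casimir_eigenvalue_def
  by (intro mult_strict_mono mult_strict_left_mono) auto

lemma monomial_tensor:
  "(\<lambda>x \<xi>. fn a x * (\<Prod>i\<leftarrow>is. \<xi> $ i)) = tensor a (prod_list (map coord is))"
  by (simp add: tensor_def o_def fun_eq_iff)

lemma euler_monomial: "euler (prod_list (map coord is)) = real (length is) *\<^sub>R prod_list (map coord is)"
proof (induction "is")
  case (Cons i "is")
  have "euler (coord i * b) = coord i * euler b + coord i * b" for b :: "'a cinf"
    by (simp add: euler_def deriv_at_mult distrib_left sum.distrib sum_distrib_left mult_ac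
        of_bool_def if_distrib[where f = "\<lambda>t. c * t" for c] cong: if_cong)
  from this[of "prod_list (map coord is)"] show ?case using Cons by (simp add: algebra_simps)
qed (simp add: euler_def)

lemma casimir_symbol_monomials:
  fixes a :: "'d::finite list \<Rightarrow> 'd cinf"
  shows "casimir_symbol (\<lambda>x \<xi>. \<Sum>is\<in>I. fn (a is) x * (\<Prod>i\<leftarrow>is. \<xi> $ i))
    = (\<lambda>x \<xi>. \<Sum>is\<in>I. casimir_eigenvalue TYPE('d) (length is) * (fn (a is) x * (\<Prod>i\<leftarrow>is. \<xi> $ i)))"
proof -
  have "casimir_symbol (\<lambda>x \<xi>. \<Sum>is\<in>I. tensor (a is) (prod_list (map coord is)) x \<xi>)
      = (\<lambda>x \<xi>. \<Sum>is\<in>I. casimir_symbol (tensor (a is) (prod_list (map coord is))) x \<xi>)"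
    by (intro casimir_symbol_sum tensor_symbol.tensor)
  then show ?thesis
    unfolding casimir_symbol_tensor[OF euler_monomial] 
    by (simp add: monomial_tensor[symmetric] casimir_eigenvalue_def)
qed

lemma casimir_symbol_homogeneous:
  fixes a :: "'d::finite list \<Rightarrow> 'd cinf"
  assumes "S = (\<lambda>x \<xi>. \<Sum>is | length is = k. fn (a is) x * (\<Prod>i\<leftarrow>is. \<xi> $ i))"
  shows "casimir_symbol S = (\<lambda>x \<xi>. casimir_eigenvalue TYPE('d) k * S x \<xi>)"
  unfolding assms casimir_symbol_monomials sum_distrib_left
  by (intro ext sum.cong) auto

lemma tensor_symbol_symbols_below:
  "F \<in> symbols_below k \<Longrightarrow> tensor_symbol F"
  unfolding symbols_below_def
  by (auto intro!: tensor_symbol_sum simp: monomial_tensor tensor_symbol.tensor)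

text \<open>Each homogeneous part of \<open>R\<close> has degree below \<open>k\<close>, hence an
  eigenvalue different from that of \<open>k\<close>.\<close>

lemma casimir_symbol_eigenvector_eq_0:
  fixes R :: "('d::finite) symb"
  assumes R: "R \<in> symbols_below k"
    and eig: "casimir_symbol R = (\<lambda>x \<xi>. casimir_eigenvalue TYPE('d) k * R x \<xi>)"
  shows "R = (\<lambda>x \<xi>. 0)"
proof (cases k)
  case 0
  then show ?thesis using R by (auto simp: symbols_below_def)
next
  case (Suc l)
  obtain a where a: "R = (\<lambda>x \<xi>. \<Sum>is | length is < k. fn (a is) x * (\<Prod>i\<leftarrow>is. \<xi> $ i))"
    using R by (auto simp: symbols_below_def)
  let ?\<alpha> = "casimir_eigenvalue TYPE('d)"
  define c where "c x \<xi> j = (\<Sum>is | length is = j. fn (a is) x * (\<Prod>i\<leftarrow>is. \<xi> $ i))"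
    for x \<xi> :: "real^'d" and j
  have group: "(\<Sum>is | length is < k. f is) = (\<Sum>j\<le>l. \<Sum>is | length is = j. f is)"
    for f :: "'d list \<Rightarrow> real"
  proof -
    have "(\<Sum>is | length is < k. f is) = (\<Sum>j\<le>l. sum f {is. is \<in> {is. length is < k} \<and> length is = j})"
      by (rule sum.group[symmetric]) (auto simp: Suc)
    also have "\<dots> = (\<Sum>j\<le>l. \<Sum>is | length is = j. f is)"
      by (intro sum.cong refl arg_cong[of _ _ "sum f"]) (auto simp: Suc)
    finally show ?thesis .
  qed
  have scal: "(\<Prod>i\<leftarrow>is. (t *\<^sub>R \<xi>) $ i) = t ^ length is * (\<Prod>i\<leftarrow>is. \<xi> $ i)"
    for t and \<xi> :: "real^'d" and "is"
    by (induction "is") auto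
  have "c x \<xi> j = 0" if "j \<le> l" for x \<xi> j
  proof -
    \<comment> \<open>Replacing \<xi> by t\<xi> multiplies the part of degree j by t^j. The
      eigenvalue equation becomes a polynomial in t that vanishes identically, so each degree can be
      treated alone.\<close>
    have "(\<Sum>j\<le>l. ((?\<alpha> j - ?\<alpha> k) * c x \<xi> j) * t ^ j) = 0" for t
    proof -
      have "(\<Sum>j\<le>l. ((?\<alpha> j - ?\<alpha> k) * c x \<xi> j) * t ^ j)
          = (\<Sum>is | length is < k. (?\<alpha> (length is) - ?\<alpha> k) * (fn (a is) x * (\<Prod>i\<leftarrow>is. (t *\<^sub>R \<xi>) $ i)))"
        unfolding group c_def sum_distrib_left sum_distrib_right
        by (intro sum.cong refl) (simp only: scal mem_Collect_eq mult_ac)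
      also have "\<dots> = casimir_symbol R x (t *\<^sub>R \<xi>) - ?\<alpha> k * R x (t *\<^sub>R \<xi>)"
        unfolding a casimir_symbol_monomials
        by (simp only: left_diff_distrib sum_subtractf sum_distrib_left)
      finally show ?thesis using eig by simp
    qed
    then have "(?\<alpha> j - ?\<alpha> k) * c x \<xi> j = 0"
      using polyfun_eq_0[of "\<lambda>j. (?\<alpha> j - ?\<alpha> k) * c x \<xi> j" l] that by blast
    then show ?thesis
      using casimir_eigenvalue_less[of j k, where 'd = 'd] that Suc by simp
  qed
  then show ?thesis
    unfolding a group c_def[symmetric] by simp
qed

section \<open>Adjoints of quantisations\<close>

definition casimir_op :: "real \<Rightarrow> ('d::finite) dop \<Rightarrow> 'd dop" where
  "casimir_op \<mu> A = (\<lambda>f.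
     (\<Sum>i\<in>UNIV. \<Sum>j\<in>UNIV. ad_weight \<mu> (linear_field i j) (ad_weight \<mu> (linear_field j i) A) f)
     + ad_weight \<mu> euler_field (ad_weight \<mu> euler_field A) f
     + (- (real CARD('d) + 1)) *\<^sub>R ad_weight \<mu> euler_field A f
     + (-2) *\<^sub>R (\<Sum>i\<in>UNIV. ad_weight \<mu> (quadratic_field i) (ad_weight \<mu> (axis i 1) A) f))"

text \<open>Adjoints pass through each \<open>ad_weight\<close> without a sign and without reversing
  nested commutators, so the same expression reappears at weight 1 - \<mu>.\<close>

lemma adj_pair_casimir_op:
  assumes "adj_pair A B"
  shows "adj_pair (casimir_op \<mu> A) (casimir_op (1 - \<mu>) B)"
  unfolding casimir_op_def
  by (rule adj_pair_add[OF adj_pair_add[OF adj_pair_add[OF adj_pair_sum[OF adj_pair_sum]]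
          adj_pair_scaleR] adj_pair_scaleR[OF adj_pair_sum]])
    (rule adj_pair_ad_weight assms)+

section \<open>Consequences of the properties of a full symbol map\<close>

lemma full_symbol_mapD:
  assumes "full_symbol_map \<mu> s"
  shows full_symbol_map_add: "\<And>A B. A \<in> all_diff_ops \<Longrightarrow> B \<in> all_diff_ops \<Longrightarrow>
      s (\<lambda>f. A f + B f) = (\<lambda>x \<xi>. s A x \<xi> + s B x \<xi>)"
    and full_symbol_map_scaleR: "\<And>A c. A \<in> all_diff_ops \<Longrightarrow>
      s (\<lambda>f. c *\<^sub>R A f) = (\<lambda>x \<xi>. c * s A x \<xi>)"
    and full_symbol_map_ad: "\<And>A K. K \<in> proj_algebra \<Longrightarrow> A \<in> all_diff_ops \<Longrightarrow>
      s (ad_weight \<mu> K A) = lie_symbol K (s A)"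
    and full_symbol_map_inj: "\<And>A B. s A = s B \<Longrightarrow> A \<in> all_diff_ops \<Longrightarrow> B \<in> all_diff_ops \<Longrightarrow> A = B"
  using assms unfolding full_symbol_map_def bij_betw_def by (auto dest: inj_onD)

lemma full_symbol_map_principal:
  assumes "full_symbol_map \<mu> s" "has_symbol k A S"
  obtains R where "R \<in> symbols_below k" "s A = (\<lambda>x \<xi>. S x \<xi> + R x \<xi>)"
proof -
  have "\<exists>R\<in>symbols_below k. s A = (\<lambda>x \<xi>. principal_symbol k A x \<xi> + R x \<xi>)"
    using assms(1) has_symbol_diff_ops[OF assms(2)] unfolding full_symbol_map_def by blast
  then show ?thesis
    using that unfolding principal_symbol_eq[OF assms(2)] by blast
qed

lemma full_symbol_map_diff:
  assumes "full_symbol_map \<mu> s" "A \<in> all_diff_ops" "B \<in> all_diff_ops"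
  shows "s (\<lambda>f. A f - B f) = (\<lambda>x \<xi>. s A x \<xi> - s B x \<xi>)"
  using full_symbol_map_add[OF assms(1,2) all_diff_ops_scaleR[OF assms(3)], of "-1"]
    full_symbol_map_scaleR[OF assms(1,3), of "-1"] by simp

lemma full_symbol_map_zero: "full_symbol_map \<mu> s \<Longrightarrow> s (\<lambda>f. 0) = (\<lambda>x \<xi>. 0)"
  using full_symbol_map_scaleR[OF _ all_diff_ops_zero, of \<mu> s 0] by simp

lemma full_symbol_map_sum:
  assumes "full_symbol_map \<mu> s" "\<And>t. t \<in> I \<Longrightarrow> A t \<in> all_diff_ops"
  shows "s (\<lambda>f. \<Sum>t\<in>I. A t f) = (\<lambda>x \<xi>. \<Sum>t\<in>I. s (A t) x \<xi>)"
  using assms(2)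
proof (induction I rule: infinite_finite_induct)
  case (insert t I)
  then show ?case
    by (simp add: full_symbol_map_add[OF assms(1)] all_diff_ops_sum)
qed (use full_symbol_map_zero[OF assms(1)] in simp_all)

lemma full_symbol_map_casimir:
  assumes s: "full_symbol_map \<mu> s" and A: "A \<in> all_diff_ops"
  shows "s (casimir_op \<mu> A) = casimir_symbol (s A)"
proof -
  note ops = all_diff_ops_add all_diff_ops_scaleR all_diff_ops_sum ad_weight_diff_op A
  show ?thesis
    unfolding casimir_op_def casimir_symbol_def
    by (simp add: full_symbol_map_add[OF s] full_symbol_map_scaleR[OF s] full_symbol_map_sum[OF s]
        full_symbol_map_ad[OF s] ops del: scaleR_minus_left scaleR_left_diff_distrib)
qed

lemma symbols_below_diff:
  assumes "F \<in> symbols_below k" "G \<in> symbols_below k"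
  shows "(\<lambda>x \<xi>. F x \<xi> - G x \<xi>) \<in> symbols_below k"
proof -
  obtain a b where "F = (\<lambda>x \<xi>. \<Sum>is | length is < k. fn (a is) x * (\<Prod>i\<leftarrow>is. \<xi> $ i))"
    "G = (\<lambda>x \<xi>. \<Sum>is | length is < k. fn (b is) x * (\<Prod>i\<leftarrow>is. \<xi> $ i))"
    using assms unfolding symbols_below_def by auto
  then show ?thesis
    unfolding symbols_below_def
    by (intro CollectI exI[of _ "\<lambda>is. a is - b is"]) (simp add: sum_subtractf left_diff_distrib)
qed

lemma symbols_below_Suc_split:
  assumes "R \<in> symbols_below (Suc k)"
  obtains A S R' where "has_symbol k A S" "R' \<in> symbols_below k" "R = (\<lambda>x \<xi>. S x \<xi> + R' x \<xi>)"
proof -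
  obtain a where a: "R = (\<lambda>x \<xi>. \<Sum>is | length is < Suc k. fn (a is) x * (\<Prod>i\<leftarrow>is. \<xi> $ i))"
    using assms unfolding symbols_below_def by auto
  have split: "{is. length is < Suc k} = {is. length is = k} \<union> {is :: 'a list. length is < k}"
    by auto
  have "R = (\<lambda>x \<xi>. (\<Sum>is | length is = k. fn (a is) x * (\<Prod>i\<leftarrow>is. \<xi> $ i))
      + (\<Sum>is | length is < k. fn (a is) x * (\<Prod>i\<leftarrow>is. \<xi> $ i)))"
    unfolding a split by (intro ext sum.union_disjoint) auto
  then show ?thesis
    by (rule that[rotated 2]) (auto simp: has_symbol_def symbols_below_def)
qed

text \<open>Bijectivity alone does not bound the order of a preimage. The top part of
  \<open>R\<close> is realised by an operator with that symbol, and the error has lower degree, to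
  which induction applies. A zero symbol at order \<open>k\<close> encodes order below
  \<open>k\<close> and makes sense for \<open>k = 0\<close> too.\<close>

lemma full_symbol_map_preimage_below:
  assumes s: "full_symbol_map \<mu> s"
  shows "R \<in> symbols_below k \<Longrightarrow> \<exists>A. has_symbol k A (\<lambda>x \<xi>. 0) \<and> s A = R"
    and "R \<in> symbols_below (Suc k) \<Longrightarrow> \<exists>A\<in>diff_ops k. s A = R"
proof -
  have step: "\<exists>A\<in>diff_ops k. s A = R"
    if IH: "\<And>R. R \<in> symbols_below k \<Longrightarrow> \<exists>A. has_symbol k A (\<lambda>x \<xi>. 0) \<and> s A = R"
      and R: "R \<in> symbols_below (Suc k)" for k R
  proof -
    obtain A S R' where A: "has_symbol k A S" and R': "R' \<in> symbols_below k"
      and RS: "R = (\<lambda>x \<xi>. S x \<xi> + R' x \<xi>)"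
      using symbols_below_Suc_split[OF R] .
    obtain R'' where R'': "R'' \<in> symbols_below k" and sA: "s A = (\<lambda>x \<xi>. S x \<xi> + R'' x \<xi>)"
      using full_symbol_map_principal[OF s A] .
    obtain B where B: "has_symbol k B (\<lambda>x \<xi>. 0)" "s B = (\<lambda>x \<xi>. R' x \<xi> - R'' x \<xi>)"
      using IH[OF symbols_below_diff[OF R' R'']] by auto
    have "s (\<lambda>f. A f + B f) = R"
      unfolding full_symbol_map_add[OF s all_diff_opsI[OF A] all_diff_opsI[OF B(1)]] sA B(2) RS by simp
    then show ?thesis
      using has_symbol_add[OF A B(1), THEN has_symbol_diff_ops] by blast
  qed
  have below: "\<exists>A. has_symbol k A (\<lambda>x \<xi>. 0) \<and> s A = R" if "R \<in> symbols_below k" for k R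
    using that
  proof (induction k arbitrary: R)
    case 0
    then show ?case
      using full_symbol_map_zero[OF s] has_symbol_0 by (auto simp: symbols_below_def)
  next
    case (Suc k)
    then obtain A S where "has_symbol k A S" "s A = R"
      using step[OF Suc.IH Suc.prems] by (auto simp: diff_ops_iff)
    then show ?case using has_symbol_mono[of k A S "Suc k"] by auto
  qed
  then show "R \<in> symbols_below k \<Longrightarrow> \<exists>A. has_symbol k A (\<lambda>x \<xi>. 0) \<and> s A = R" by blast
  show "R \<in> symbols_below (Suc k) \<Longrightarrow> \<exists>A\<in>diff_ops k. s A = R"
    by (rule step[OF below])
qed

text \<open>The operator \<open>A\<close> witnesses that \<open>S\<close> is a symbol of degree
  \<open>k\<close>; subtracting the preimage of the lower terms of its full symbol leaves exactly
  \<open>S\<close>.\<close>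

lemma full_symbol_map_preimage:
  assumes s: "full_symbol_map \<mu> s" and A: "has_symbol k A S"
  obtains B where "has_symbol k B S" "s B = S"
proof -
  obtain R where R: "R \<in> symbols_below k" and sA: "s A = (\<lambda>x \<xi>. S x \<xi> + R x \<xi>)"
    using full_symbol_map_principal[OF s A] .
  obtain C where C: "has_symbol k C (\<lambda>x \<xi>. 0)" "s C = R"
    using full_symbol_map_preimage_below(1)[OF s R] by auto
  have "s (\<lambda>f. A f - C f) = S"
    unfolding full_symbol_map_diff[OF s all_diff_opsI[OF A] all_diff_opsI[OF C(1)]] sA C(2) by simp
  moreover have "has_symbol k (\<lambda>f. A f - C f) S"
    using has_symbol_add[OF A has_symbol_scaleR[OF C(1), of "-1"]] by simp
  ultimately show ?thesis by (rule that[rotated])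
qed

lemma quantise:
  assumes s: "full_symbol_map \<mu> (\<sigma> \<mu>)" and A: "has_symbol k A S"
  shows "has_symbol k (quantise \<sigma> \<mu> S) S" "\<sigma> \<mu> (quantise \<sigma> \<mu> S) = S"
proof -
  obtain B where B: "has_symbol k B S" "\<sigma> \<mu> B = S"
    using full_symbol_map_preimage[OF s A] .
  have "inj_on (\<sigma> \<mu>) all_diff_ops"
    using s by (simp add: full_symbol_map_def bij_betw_def)
  then have "quantise \<sigma> \<mu> S = B"
    unfolding quantise_def using inv_into_f_f[OF _ all_diff_opsI[OF B(1)], of "\<sigma> \<mu>"] B(2) by simp
  then show "has_symbol k (quantise \<sigma> \<mu> S) S" "\<sigma> \<mu> (quantise \<sigma> \<mu> S) = S"
    using B by simp_all
qed

lemma casimir_has_symbol: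
  fixes A :: "('d::finite) dop"
  assumes "has_symbol k A S"
  shows "casimir_symbol S = (\<lambda>x \<xi>. casimir_eigenvalue TYPE('d) k * S x \<xi>)"
  using assms unfolding has_symbol_def by (blast intro: casimir_symbol_homogeneous)

lemma tensor_symbol_has_symbol: "has_symbol k A S \<Longrightarrow> tensor_symbol S"
  unfolding has_symbol_def
  by (auto intro!: tensor_symbol_sum simp: monomial_tensor tensor_symbol.tensor)

text \<open>The adjoint \<open>B\<close> of the quantisation of \<open>S\<close> is a Casimir eigenvector for the eigenvalue of
  degree \<open>k\<close>, since taking adjoints intertwines the Casimir operators of weight \<open>\<mu>\<close> and \<open>1 - \<mu>\<close>.
  As the eigenvalues are distinct, the full symbol of \<open>B\<close> has no terms of degree below \<open>k\<close>.\<close>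

lemma adj_pair_quantise:
  fixes \<sigma> :: "real \<Rightarrow> ('d::finite) dop \<Rightarrow> 'd symb" and \<psi> :: "'d cinf"
  assumes s: "\<And>\<mu>. full_symbol_map \<mu> (\<sigma> \<mu>)" and C: "has_symbol k C S"
    and \<psi>: "test_function \<psi>" "\<psi> \<noteq> 0"
  shows "adj_pair (quantise \<sigma> \<mu> S) (\<lambda>f. (-1) ^ k *\<^sub>R quantise \<sigma> (1 - \<mu>) S f)"
proof -
  let ?\<alpha> = "casimir_eigenvalue TYPE('d) k"
  let ?\<mu> = "1 - \<mu>"
  define A where "A = quantise \<sigma> \<mu> S"
  have A: "has_symbol k A S" "\<sigma> \<mu> A = S"
    unfolding A_def by (rule quantise[OF s C])+
  have A': "A \<in> all_diff_ops" by (rule all_diff_opsI[OF A(1)])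
  have Q: "has_symbol k (quantise \<sigma> ?\<mu> S) S" "\<sigma> ?\<mu> (quantise \<sigma> ?\<mu> S) = S"
    by (rule quantise[OF s C])+
  have Q': "quantise \<sigma> ?\<mu> S \<in> all_diff_ops" by (rule all_diff_opsI[OF Q(1)])
  obtain B where B: "has_symbol k B (\<lambda>x \<xi>. (-1) ^ k * S x \<xi>)" and AB: "adj_pair A B"
    using adj_pair_exists[OF A(1)] by auto
  have B': "B \<in> all_diff_ops" by (rule all_diff_opsI[OF B])
  have AB': "adj_pair (casimir_op \<mu> A) (casimir_op ?\<mu> B)"
    by (rule adj_pair_casimir_op[OF AB])
  have "casimir_op \<mu> A = (\<lambda>f. ?\<alpha> *\<^sub>R A f)"
  proof (rule full_symbol_map_inj[OF s])
    show "\<sigma> \<mu> (casimir_op \<mu> A) = \<sigma> \<mu> (\<lambda>f. ?\<alpha> *\<^sub>R A f)"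
      unfolding full_symbol_map_casimir[OF s A'] full_symbol_map_scaleR[OF s A'] A(2)
      by (rule casimir_has_symbol[OF C])
    show "casimir_op \<mu> A \<in> all_diff_ops" using AB' by (simp add: adj_pair_def)
    show "(\<lambda>f. ?\<alpha> *\<^sub>R A f) \<in> all_diff_ops" by (rule all_diff_ops_scaleR[OF A'])
  qed
  \<comment> \<open>Both sides are adjoint to the same operator, \<open>?\<alpha>\<close> times
    \<open>A\<close>; here uniqueness of adjoints, and with it \<open>\<psi>\<close>,
    enters.\<close>
  with AB' adj_pair_scaleR[OF AB] have "casimir_op ?\<mu> B = (\<lambda>f. ?\<alpha> *\<^sub>R B f)"
    by (intro adj_pair_unique[OF _ _ \<psi>]) auto
  then have eig: "casimir_symbol (\<sigma> ?\<mu> B) = (\<lambda>x \<xi>. ?\<alpha> * \<sigma> ?\<mu> B x \<xi>)"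
    using full_symbol_map_casimir[OF s B', of ?\<mu>] full_symbol_map_scaleR[OF s B', of ?\<mu> ?\<alpha>] by simp
  obtain R where R: "R \<in> symbols_below k" and \<sigma>B: "\<sigma> ?\<mu> B = (\<lambda>x \<xi>. (-1) ^ k * S x \<xi> + R x \<xi>)"
    using full_symbol_map_principal[OF s B, of ?\<mu>] .
  have "casimir_symbol (\<sigma> ?\<mu> B) = (\<lambda>x \<xi>. ?\<alpha> * ((-1) ^ k * S x \<xi>) + casimir_symbol R x \<xi>)"
    unfolding \<sigma>B casimir_symbol_add[OF tensor_symbol_has_symbol[OF B] tensor_symbol_symbols_below[OF R]]
      casimir_has_symbol[OF B] ..
  with eig have "casimir_symbol R = (\<lambda>x \<xi>. ?\<alpha> * R x \<xi>)"
    unfolding \<sigma>B by (simp add: fun_eq_iff distrib_left)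
  then have "R = (\<lambda>x \<xi>. 0)" by (rule casimir_symbol_eigenvector_eq_0[OF R])
  then have "\<sigma> ?\<mu> B = \<sigma> ?\<mu> (\<lambda>f. (-1) ^ k *\<^sub>R quantise \<sigma> ?\<mu> S f)"
    unfolding \<sigma>B full_symbol_map_scaleR[OF s Q'] Q(2) by simp
  then have "B = (\<lambda>f. (-1) ^ k *\<^sub>R quantise \<sigma> ?\<mu> S f)"
    by (rule full_symbol_map_inj[OF s _ B' all_diff_ops_scaleR[OF Q']])
  then show ?thesis using AB unfolding A_def by simp
qed

text \<open>Subtracting the quantised leading symbol removes it from the full symbol as well. The
  rest has degree below \<open>n - i\<close>, so its preimage has order at most
  \<open>n - Suc i\<close>, and injectivity identifies the two operators.\<close>

lemma canonical_remainder_diff_ops: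
  assumes s: "full_symbol_map \<nu> (\<sigma> \<nu>)" and \<Delta>: "\<Delta> \<in> diff_ops n"
  shows "i \<le> n \<Longrightarrow> canonical_remainder \<sigma> \<nu> n \<Delta> i \<in> diff_ops (n - i)"
proof (induction i)
  case (Suc i)
  let ?R = "canonical_remainder \<sigma> \<nu> n \<Delta> i"
  obtain S where S: "has_symbol (n - i) ?R S"
    using Suc by (auto simp: diff_ops_iff)
  let ?A = "quantise \<sigma> \<nu> S"
  have A: "has_symbol (n - i) ?A S" "\<sigma> \<nu> ?A = S"
    by (rule quantise[where \<sigma> = \<sigma>, OF s S])+
  obtain R where R: "R \<in> symbols_below (n - i)" "\<sigma> \<nu> ?R = (\<lambda>x \<xi>. S x \<xi> + R x \<xi>)"
    using full_symbol_map_principal[OF s S] .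
  have R': "?R \<in> all_diff_ops" "?A \<in> all_diff_ops"
    using all_diff_opsI[OF S] all_diff_opsI[OF A(1)] .
  have "\<sigma> \<nu> (\<lambda>f. ?R f - ?A f) = R"
    unfolding full_symbol_map_diff[OF s R'] R(2) A(2) by simp
  moreover have "R \<in> symbols_below (Suc (n - Suc i))"
    using R(1) Suc.prems by (simp add: Suc_diff_Suc)
  then obtain C where C: "C \<in> diff_ops (n - Suc i)" "\<sigma> \<nu> C = R"
    using full_symbol_map_preimage_below(2)[OF s] by blast
  ultimately have "(\<lambda>f. ?R f - ?A f) = C"
    using C by (intro full_symbol_map_inj[OF s _ all_diff_ops_diff[OF R']])
      (auto simp: all_diff_ops_def)
  then show ?case
    using C(1) by (simp add: principal_symbol_eq[OF S])
qed (use \<Delta> in simp)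


section \<open>The algebra of densities\<close>

lemma lookup_fmult_of_real: "Poly_Mapping.lookup (fmult (of_real c) s) \<mu> = c *\<^sub>R Poly_Mapping.lookup s \<mu>"
  unfolding fmult_def
  by (simp add: mult_map_scale_conv_mult[symmetric] Poly_Mapping.map.rep_eq scaleR_conv_of_real when_def)

text \<open>\<open>Poly_Mapping.mapp\<close> acts on the support only, so off the support the
  equation requires \<open>A \<mu> 0 = 0\<close>.\<close>

lemma lookup_of_pencil: "A \<mu> 0 = 0 \<Longrightarrow> Poly_Mapping.lookup (of_pencil A s) \<mu> = A \<mu> (Poly_Mapping.lookup s \<mu>)"
  unfolding of_pencil_def by (auto simp: lookup_mapp when_def in_keys_iff)

lemma lookup_weight_op_power: "Poly_Mapping.lookup ((weight_op ^^ k) s) \<mu> = \<mu> ^ k *\<^sub>R Poly_Mapping.lookup s \<mu>"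
  by (induction k) (simp_all add: weight_op_def lookup_of_pencil)

lemma lookup_poly_weight: "Poly_Mapping.lookup (poly_weight p s) \<mu> = poly p \<mu> *\<^sub>R Poly_Mapping.lookup s \<mu>"
  by (simp add: poly_weight_def lookup_sum lookup_fmult_of_real lookup_weight_op_power poly_altdef
      scaleR_sum_left)

lemma compactly_supported_iff: "compactly_supported s \<longleftrightarrow> (\<forall>\<mu>. test_function (Poly_Mapping.lookup s \<mu>))"
  by (simp add: compactly_supported_def test_function_def)

text \<open>The free index set allows \<open>pairing (U s) t\<close> to be summed over the support
  of \<open>s\<close>, which may be larger than that of \<open>U s\<close>.\<close>

lemma pairing_eq:
  assumes "finite X" "Poly_Mapping.keys s \<subseteq> X"
  shows "pairing s t = (\<Sum>\<mu>\<in>X. inner_L2 (Poly_Mapping.lookup s \<mu>) (Poly_Mapping.lookup t (1 - \<mu>)))"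
  unfolding pairing_def inner_L2_def[symmetric]
  by (rule sum.mono_neutral_left) (use assms in \<open>auto simp: in_keys_iff\<close>)

text \<open>Reduces adjointness on the algebra to each weight: the component of weight \<mu> meets
  the component of weight 1 - \<mu>, hence \<open>N (1 - \<mu>)\<close>.\<close>

lemma pairing_adj_pair:
  assumes U: "\<And>s \<mu>. Poly_Mapping.lookup (U s) \<mu> = M \<mu> (Poly_Mapping.lookup s \<mu>)"
    and T: "\<And>t \<mu>. Poly_Mapping.lookup (T t) \<mu> = N \<mu> (Poly_Mapping.lookup t \<mu>)"
    and adj: "\<And>\<mu>. adj_pair (M \<mu>) (N (1 - \<mu>))"
    and cs: "compactly_supported s" "compactly_supported t"
  shows "pairing (U s) t = pairing s (T t)"
proof -
  have "Poly_Mapping.keys (U s) \<subseteq> Poly_Mapping.keys s"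
  proof
    fix \<mu> assume "\<mu> \<in> Poly_Mapping.keys (U s)"
    then show "\<mu> \<in> Poly_Mapping.keys s"
      using adj[of \<mu>] all_diff_ops_0_arg[of "M \<mu>"] by (auto simp: in_keys_iff U adj_pair_def)
  qed
  then have "pairing (U s) t = (\<Sum>\<mu>\<in>Poly_Mapping.keys s.
      inner_L2 (M \<mu> (Poly_Mapping.lookup s \<mu>)) (Poly_Mapping.lookup t (1 - \<mu>)))"
    by (subst pairing_eq[of "Poly_Mapping.keys s"]) (auto simp: U)
  also have "\<dots> = (\<Sum>\<mu>\<in>Poly_Mapping.keys s.
      inner_L2 (Poly_Mapping.lookup s \<mu>) (N (1 - \<mu>) (Poly_Mapping.lookup t (1 - \<mu>))))"
    using adj cs by (intro sum.cong) (auto simp: adj_pair_def compactly_supported_iff)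
  also have "\<dots> = pairing s (T t)"
    by (subst pairing_eq[of "Poly_Mapping.keys s"]) (auto simp: T)
  finally show ?thesis .
qed

text \<open>Testing on \<open>\<psi>\<close> placed at weights \<mu> and 1 - \<mu> turns adjointness
  into a numerical identity, with the nonzero factor \<open>inner_L2 \<psi> \<psi>\<close> on both
  sides.\<close>

lemma poly_weight_adjoint_reflect:
  fixes \<psi> :: "('d::finite) cinf"
  assumes adj: "is_adjoint (poly_weight p :: 'd densop) (poly_weight q)"
    and \<psi>: "test_function \<psi>" "\<psi> \<noteq> 0"
  shows "poly p \<mu> = poly q (1 - \<mu>)"
proof -
  let ?s = "Poly_Mapping.single \<mu> \<psi>" and ?t = "Poly_Mapping.single (1 - \<mu>) \<psi>"
  have cs: "compactly_supported ?s" "compactly_supported ?t"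
    using \<psi>(1) by (auto simp: compactly_supported_iff lookup_single when_def)
  have "Poly_Mapping.keys (poly_weight p ?s) \<subseteq> {\<mu>}"
    by (auto simp: in_keys_iff lookup_poly_weight lookup_single when_def split: if_splits)
  then have "pairing (poly_weight p ?s) ?t = poly p \<mu> * inner_L2 \<psi> \<psi>"
    by (subst pairing_eq[of "{\<mu>}"]) (auto simp: lookup_poly_weight lookup_single)
  moreover have "pairing ?s (poly_weight q ?t) = poly q (1 - \<mu>) * inner_L2 \<psi> \<psi>"
    by (subst pairing_eq[of "{\<mu>}"]) (auto simp: lookup_poly_weight lookup_single)
  moreover have "inner_L2 \<psi> \<psi> \<noteq> 0"
    using inner_L2_self_eq_0 \<psi> by blast
  ultimately show ?thesis
    using adj cs unfolding is_adjoint_def by simp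
qed

lemma lifting_adjoint:
  fixes n :: nat and \<nu> :: real
    and \<sigma> :: "real \<Rightarrow> ('d::finite) dop \<Rightarrow> 'd symb"
    and L :: "'d dop \<Rightarrow> 'd densop"
    and P :: "nat \<Rightarrow> real poly"
  assumes symbol_map: "\<And>\<mu>. full_symbol_map \<mu> (\<sigma> \<mu>)"
    and form: "\<And>\<Delta>. \<Delta> \<in> diff_ops n \<Longrightarrow>
      L \<Delta> = (\<lambda>s. \<Sum>i\<le>n. poly_weight (smult (1 / poly (P i) \<nu>) (P i))
                          (dlo_lifting \<sigma> \<nu> (canonical_part \<sigma> \<nu> n \<Delta> i) s))"
    and adjoint_P: "\<And>i. i \<le> n \<Longrightarrow>
      is_adjoint (poly_weight (P i) :: 'd densop) (poly_weight (smult ((-1) ^ i) (P i)))"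
    and \<Delta>: "\<Delta> \<in> diff_ops n"
    and cs: "compactly_supported s" "compactly_supported t"
  shows "pairing (L \<Delta> s) t = pairing s (fmult (of_real ((-1) ^ n)) (L \<Delta> t))"
  \<comment> \<open>A nonzero compactly supported smooth function is not constructed: without one both sides vanish.\<close>
proof (cases "\<exists>\<psi> :: 'd cinf. test_function \<psi> \<and> \<psi> \<noteq> 0")
  case False
  then have "Poly_Mapping.lookup s \<mu> = 0" "Poly_Mapping.lookup t \<mu> = 0" for \<mu>
    using cs by (auto simp: compactly_supported_iff)
  then show ?thesis
    by (simp add: pairing_eq[OF finite_keys order_refl])
next
  case True
  then obtain \<psi> :: "'d cinf" where \<psi>: "test_function \<psi>" "\<psi> \<noteq> 0" by blast
  have "\<exists>S. has_symbol (n - i) (canonical_remainder \<sigma> \<nu> n \<Delta> i) S" if "i \<le> n" for i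
    using canonical_remainder_diff_ops[where \<sigma> = \<sigma>, OF symbol_map \<Delta> that] by (simp add: diff_ops_iff)
  then obtain S where S: "\<And>i. i \<le> n \<Longrightarrow> has_symbol (n - i) (canonical_remainder \<sigma> \<nu> n \<Delta> i) (S i)"
    by metis
  have Q: "quantise \<sigma> \<mu> (S i) \<in> all_diff_ops" if "i \<le> n" for i \<mu>
    by (rule all_diff_opsI[OF quantise(1)[where \<sigma> = \<sigma>, OF symbol_map S[OF that]]])
  define M where "M \<mu> f = (\<Sum>i\<le>n. (poly (P i) \<mu> / poly (P i) \<nu>) *\<^sub>R quantise \<sigma> \<mu> (S i) f)" for \<mu> f
  have lookup_L: "Poly_Mapping.lookup (L \<Delta> s) \<mu> = M \<mu> (Poly_Mapping.lookup s \<mu>)" for s \<mu>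
  proof -
    \<comment> \<open>The canonical part is itself the quantisation of \<open>S i\<close>, so its
      full symbol at weight \<open>\<nu>\<close> is exactly \<open>S i\<close>, and the lifting
      quantises this symbol at every weight.\<close>
    have "dlo_lifting \<sigma> \<nu> (canonical_part \<sigma> \<nu> n \<Delta> i) = of_pencil (\<lambda>\<mu>. quantise \<sigma> \<mu> (S i))" if "i \<le> n" for i
      unfolding dlo_lifting_def canonical_part_def principal_symbol_eq[OF S[OF that]]
        quantise(2)[where \<sigma> = \<sigma>, OF symbol_map S[OF that]] ..
    then show ?thesis
      unfolding form[OF \<Delta>] M_def
      by (simp add: lookup_sum lookup_poly_weight lookup_of_pencil all_diff_ops_0_arg[OF Q])
  qed
  have adj: "adj_pair (M \<mu>) (\<lambda>f. (-1) ^ n *\<^sub>R M (1 - \<mu>) f)" for \<mu>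
  proof -
    have 1: "adj_pair (M \<mu>) (\<lambda>f. \<Sum>i\<le>n. (poly (P i) \<mu> / poly (P i) \<nu>) *\<^sub>R
        ((-1) ^ (n - i) *\<^sub>R quantise \<sigma> (1 - \<mu>) (S i) f))"
      unfolding M_def
    proof (rule adj_pair_sum)
      fix i assume "i \<in> {..n}"
      then have "has_symbol (n - i) (canonical_remainder \<sigma> \<nu> n \<Delta> i) (S i)" by (intro S) simp
      from adj_pair_scaleR[OF adj_pair_quantise[where \<sigma> = \<sigma>, OF symbol_map this \<psi>]]
      show "adj_pair (\<lambda>f. (poly (P i) \<mu> / poly (P i) \<nu>) *\<^sub>R quantise \<sigma> \<mu> (S i) f)
          (\<lambda>f. (poly (P i) \<mu> / poly (P i) \<nu>) *\<^sub>R
            ((-1) ^ (n - i) *\<^sub>R quantise \<sigma> (1 - \<mu>) (S i) f))" .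
    qed
    have "(poly (P i) \<mu> / poly (P i) \<nu>) *\<^sub>R ((-1) ^ (n - i) *\<^sub>R g)
        = (-1) ^ n *\<^sub>R (poly (P i) (1 - \<mu>) / poly (P i) \<nu>) *\<^sub>R g" if "i \<le> n" for i and g :: "'d cinf"
    proof -
      have "poly (P i) \<mu> = (-1) ^ i * poly (P i) (1 - \<mu>)"
        using poly_weight_adjoint_reflect[OF adjoint_P[OF that] \<psi>, of \<mu>] by simp
      moreover have "(-1) ^ n = (-1 :: real) ^ i * (-1) ^ (n - i)"
        using that by (simp add: power_add[symmetric])
      ultimately show ?thesis by simp
    qed
    then have "(\<Sum>i\<le>n. (poly (P i) \<mu> / poly (P i) \<nu>) *\<^sub>R
        ((-1) ^ (n - i) *\<^sub>R quantise \<sigma> (1 - \<mu>) (S i) f)) = (-1) ^ n *\<^sub>R M (1 - \<mu>) f" for f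
      unfolding M_def scaleR_sum_right by (intro sum.cong) simp_all
    with 1 show ?thesis by simp
  qed
  show ?thesis
    by (rule pairing_adj_pair[OF lookup_L _ adj cs]) (simp only: lookup_fmult_of_real lookup_L)
qed

theorem proposition4:
  fixes n :: nat and \<nu> :: real
    and \<sigma> :: "real \<Rightarrow> ('d::finite) dop \<Rightarrow> 'd symb"
    and L :: "'d dop \<Rightarrow> 'd densop"
    and P :: "nat \<Rightarrow> real poly"
  assumes symbol_map: "\<And>\<mu>. full_symbol_map \<mu> (\<sigma> \<mu>)"
    and lifting: "pencil_lifting n \<nu> L"
    and regular: "regular_lifting n L"
    and equivariant: "equivariant_lifting proj_algebra n \<nu> L"
    and degree_P: "\<And>i. i \<le> n \<Longrightarrow> degree (P i) \<le> i"
    and P_nonzero: "\<And>i. i \<le> n \<Longrightarrow> poly (P i) \<nu> \<noteq> 0"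
    and form: "\<And>\<Delta>. \<Delta> \<in> diff_ops n \<Longrightarrow>
      L \<Delta> = (\<lambda>s. \<Sum>i\<le>n. poly_weight (smult (1 / poly (P i) \<nu>) (P i))
                          (dlo_lifting \<sigma> \<nu> (canonical_part \<sigma> \<nu> n \<Delta> i) s))"
    and adjoint_P: "\<And>i. i \<le> n \<Longrightarrow>
      is_adjoint (poly_weight (P i) :: 'd densop) (poly_weight (smult ((-1) ^ i) (P i)))"
  shows "(even n \<longrightarrow> (\<forall>\<Delta>\<in>diff_ops n. is_adjoint (L \<Delta>) (L \<Delta>))) \<and>
         (odd n \<longrightarrow> (\<forall>\<Delta>\<in>diff_ops n. is_adjoint (L \<Delta>) (\<lambda>s. - L \<Delta> s)))"
proof -
  \<comment> \<open>Besides the pairing identity, \<open>is_adjoint\<close> requires the adjoint to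
    be a weight-zero differential operator.\<close>
  have ops: "L \<Delta> \<in> all_weight_zero_ops" if "\<Delta> \<in> diff_ops n" for \<Delta>
    using lifting that by (auto simp: pencil_lifting_def)
  note adj = lifting_adjoint[OF symbol_map form adjoint_P]
  have neg: "fmult (of_real (-1)) s = - s" for s :: "'d density"
    by (rule poly_mapping_eqI) (simp only: lookup_fmult_of_real lookup_uminus, simp)
  have "is_adjoint (L \<Delta>) (L \<Delta>)" if "even n" "\<Delta> \<in> diff_ops n" for \<Delta>
  proof -
    have "fmult (of_real 1) s = s" for s :: "'d density"
      by (rule poly_mapping_eqI) (simp only: lookup_fmult_of_real scaleR_one)
    then show ?thesis
      using adj[OF _ _ that(2)] ops[OF that(2)] that(1) by (simp add: is_adjoint_def)
  qed
  moreover have "is_adjoint (L \<Delta>) (\<lambda>s. - L \<Delta> s)" if "odd n" "\<Delta> \<in> diff_ops n" for \<Delta>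
  proof -
    \<comment> \<open>By linearity the negative of \<open>L \<Delta>\<close> is the lifting of the
      negative of \<Delta>, hence again a weight-zero differential operator.\<close>
    have "L (\<lambda>f. (-1) *\<^sub>R \<Delta> f) = (\<lambda>s. fmult (of_real (-1)) (L \<Delta> s))"
      using lifting that(2) unfolding pencil_lifting_def by blast
    moreover have "(\<lambda>f. (-1) *\<^sub>R \<Delta> f) \<in> diff_ops n"
      using that(2) has_symbol_scaleR[of n \<Delta> _ "-1"] by (auto simp: diff_ops_iff)
    ultimately have "(\<lambda>s. - L \<Delta> s) \<in> all_weight_zero_ops"
      using ops unfolding neg by metis
    moreover have "(-1 :: real) ^ n = -1" using that(1) by simp
    ultimately show ?thesis
      using adj[OF _ _ that(2)] unfolding is_adjoint_def by (simp only: neg) blast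
  qed
  ultimately show ?thesis by blast
qed

end
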